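(* Let $X,Y$ be Banach spaces over $\mathbb{K}$ and let $\mathcal{Z}$ be a linear subspace of $\ell_\infty(B_X)$. Assume $\Phi\in\ell_\infty(B_X,Y)$ with $\|\Phi\|=1$. Then the following are equivalent: (1) For every $x'\in\mathcal{Z}$ and every $y\in Y$, $\|\Phi+x'\otimes y\|=\|\Phi\|+\|x'\otimes y\|$. (2) For every $x'\in S_{\mathcal{Z}}$, every $y\in S_Y$, and every $\varepsilon>0$, there exist $\omega\in\mathbb{T}$ and $x\in B_X$ such that $$\operatorname{Re}\omega x'(x)\ge1-\varepsilon\quad\text{and}\quad\|\omega\Phi(x)+y\|\ge2-\varepsilon.$$ (3) Every weakly compact $\Psi\in\ell_\infty(B_X,Y)$ such that $y^*\circ\Psi\in\mathcal{Z}$ for all $y^*\in Y^*$ satisfies $\|\Phi+\Psi\|=\|\Phi\|+\|\Psi\|$.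
   Context: $\mathbb{K}$ is $\mathbb{R}$ or $\mathbb{C}$, and $\mathbb{T}=\{\omega\in\mathbb{K}:|\omega|=1\}$. $B_X$ is the closed unit ball and $S_X$ the unit sphere of a normed space $X$; $Y^*$ is the dual of $Y$. $\ell_\infty(B_X,Y)$ is the space of all bounded (not necessarily linear or continuous) maps $\Phi:B_X\to Y$ with $\|\Phi\|=\sup_{x\in B_X}\|\Phi(x)\|$; $\ell_\infty(B_X)=\ell_\infty(B_X,\mathbb{K})$, and $S_{\mathcal{Z}}$ is the unit sphere of $\mathcal{Z}$ in this norm. For $x'\in\ell_\infty(B_X)$ and $y\in Y$, $x'\otimes y$ is the map $x\mapsto x'(x)y$. $\Psi\in\ell_\infty(B_X,Y)$ is weakly compact if the weak closure of $\Psi(B_X)$ is a weakly compact set. *)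

theory Defs
  imports "HOL-Analysis.Analysis" "HOL-Library.Function_Algebras"
begin

(* The scalar field K. A type of this class is identified with a real subalgebra of the
   complex numbers, so it is isometrically isomorphic to the reals or to the complex numbers
   (range_to_complex). *)
class real_or_complex = real_normed_field +
  fixes to_complex :: "'a \<Rightarrow> complex"
  assumes to_complex_add: "to_complex (x + y) = to_complex x + to_complex y"
    and to_complex_mult: "to_complex (x * y) = to_complex x * to_complex y"
    and to_complex_scaleR: "to_complex (r *\<^sub>R x) = r *\<^sub>R to_complex x"
    and norm_to_complex: "norm (to_complex x) = norm x"

instantiation real :: real_or_complex
begin

definition to_complex_real :: "real \<Rightarrow> complex" where
  "to_complex_real = complex_of_real"

instance
  by standard (auto simp: to_complex_real_def scaleR_conv_of_real)

end

instantiation complex :: real_or_complex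
begin

definition to_complex_complex :: "complex \<Rightarrow> complex" where
  "to_complex_complex z = z"

instance
  by standard (auto simp: to_complex_complex_def)

end

lemma inj_to_complex: "inj (to_complex :: 'k::real_or_complex \<Rightarrow> complex)"
proof (rule injI)
  fix x y :: 'k
  assume eq: "to_complex x = to_complex y"
  have "to_complex x = to_complex (x - y) + to_complex y"
    using to_complex_add[of "x - y" y] by simp
  then have "norm (x - y) = 0"
    using eq norm_to_complex[of "x - y"] by simp
  then show "x = y" by simp
qed

lemma to_complex_of_real:
  "to_complex (of_real r :: 'k::real_or_complex) = complex_of_real r"
proof -
  have "to_complex (1::'k) * to_complex (1::'k) = to_complex (1::'k)"
    using to_complex_mult[of "1::'k" 1] by simp
  moreover have "to_complex (1::'k) \<noteq> 0"
    using norm_to_complex[of "1::'k"] by auto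
  ultimately have "to_complex (1::'k) = 1" by simp
  then show ?thesis
    using to_complex_scaleR[of r "1::'k"] by (simp add: of_real_def)
qed

lemma range_to_complex:
  "range (to_complex :: 'k::real_or_complex \<Rightarrow> complex) = \<real> \<or>
   range (to_complex :: 'k \<Rightarrow> complex) = UNIV"
proof (cases "range (to_complex :: 'k \<Rightarrow> complex) \<subseteq> \<real>")
  case True
  moreover have "z \<in> range (to_complex :: 'k \<Rightarrow> complex)" if "z \<in> \<real>" for z
    using that by (metis Reals_cases rangeI to_complex_of_real)
  ultimately show ?thesis by blast
next
  case False
  then obtain u :: 'k where "Im (to_complex u) \<noteq> 0"
    using complex_is_Real_iff by blast
  define w where "w = to_complex u"
  have w: "Im w \<noteq> 0" using \<open>Im (to_complex u) \<noteq> 0\<close> by (simp add: w_def)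
  have "z \<in> range (to_complex :: 'k \<Rightarrow> complex)" for z
  proof -
    define b where "b = Im z / Im w"
    define a where "a = Re z - b * Re w"
    have "to_complex (of_real a + b *\<^sub>R u) = complex_of_real a + b *\<^sub>R w"
      by (simp add: to_complex_add to_complex_of_real to_complex_scaleR w_def)
    also have "\<dots> = z"
      using w by (simp add: complex_eq_iff a_def b_def)
    finally show ?thesis by (metis rangeI)
  qed
  then show ?thesis by blast
qed

definition re :: "'k::real_or_complex \<Rightarrow> real" where
  "re z = Re (to_complex z)"

(* A K-Banach space: its real structure and its norm come from the type class banach. *)
locale banach_space_over = vector_space smul
  for smul :: "'k::real_or_complex \<Rightarrow> 'a::banach \<Rightarrow> 'a" +
  assumes scale_of_real: "smul (of_real r) x = r *\<^sub>R x"
    and norm_scale: "norm (smul c x) = norm c * norm x"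

(* A map on the closed unit ball is represented by its extension by zero to the whole space,
   so that equality and the vector space operations are those of functions on the type. *)
definition linf_ball :: "('a::real_normed_vector \<Rightarrow> 'b::real_normed_vector) set" where
  "linf_ball = {f. bounded (f ` cball 0 1) \<and> (\<forall>x. x \<notin> cball 0 1 \<longrightarrow> f x = 0)}"

definition sup_norm :: "('a::real_normed_vector \<Rightarrow> 'b::real_normed_vector) \<Rightarrow> real" where
  "sup_norm f = (SUP x\<in>cball 0 1. norm (f x))"

definition tensor :: "('k \<Rightarrow> 'b \<Rightarrow> 'b) \<Rightarrow> ('a \<Rightarrow> 'k) \<Rightarrow> 'b \<Rightarrow> 'a \<Rightarrow> 'b" where
  "tensor smul x' y = (\<lambda>x. smul (x' x) y)"

definition dual ::
  "('k::real_or_complex \<Rightarrow> 'b::real_normed_vector \<Rightarrow> 'b) \<Rightarrow> ('b \<Rightarrow> 'k) set" where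
  "dual smul = {f. bounded_linear f \<and> (\<forall>c y. f (smul c y) = c * f y)}"

definition weak_topology ::
  "('k::real_or_complex \<Rightarrow> 'b::real_normed_vector \<Rightarrow> 'b) \<Rightarrow> 'b topology" where
  "weak_topology smul = topology_generated_by {f -` U | f U. f \<in> dual smul \<and> open U}"

definition weakly_compact_map ::
  "('k::real_or_complex \<Rightarrow> 'b::real_normed_vector \<Rightarrow> 'b) \<Rightarrow>
   ('a::real_normed_vector \<Rightarrow> 'b) \<Rightarrow> bool" where
  "weakly_compact_map smul \<Psi> \<longleftrightarrow>
     compactin (weak_topology smul) (weak_topology smul closure_of (\<Psi> ` cball 0 1))"

definition scale_fun :: "'k::real_or_complex \<Rightarrow> ('a \<Rightarrow> 'k) \<Rightarrow> 'a \<Rightarrow> 'k" where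
  "scale_fun c f = (\<lambda>x. c * f x)"

interpretation scale_fun: vector_space "scale_fun :: 'k::real_or_complex \<Rightarrow> ('a \<Rightarrow> 'k) \<Rightarrow> 'a \<Rightarrow> 'k"
  by standard (auto simp: scale_fun_def fun_eq_iff algebra_simps)

lemma subspace_linf_ball:
  "scale_fun.subspace (linf_ball :: ('a::real_normed_vector \<Rightarrow> 'k::real_or_complex) set)"
proof (rule scale_fun.subspaceI)
  fix f g :: "'a \<Rightarrow> 'k" and c :: 'k
  show "(0 :: 'a \<Rightarrow> 'k) \<in> linf_ball"
    by (auto simp: linf_ball_def bounded_iff)
  assume f: "f \<in> linf_ball"
  then obtain B where B: "\<forall>x\<in>cball 0 1. norm (f x) \<le> B"
    unfolding linf_ball_def bounded_iff by blast
  then have "\<forall>x\<in>cball 0 1. norm (c * f x) \<le> norm c * B"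
    by (auto simp: norm_mult intro!: mult_left_mono)
  then show "scale_fun c f \<in> linf_ball"
    using f unfolding linf_ball_def scale_fun_def bounded_iff by auto
  assume g: "g \<in> linf_ball"
  then obtain C where "\<forall>x\<in>cball 0 1. norm (g x) \<le> C"
    unfolding linf_ball_def bounded_iff by blast
  then have "\<forall>x\<in>cball 0 1. norm (f x + g x) \<le> B + C"
    using B by (blast intro: norm_triangle_mono)
  then show "f + g \<in> linf_ball"
    using f g unfolding linf_ball_def bounded_iff by auto
qed

end

theory Submission
  imports Defs
begin

text \<open>
  The implications (3) to (1) and (1) to (2) are elementary. For (2) to (3), let \<open>W\<close> be the set of unimodular
  multiples of the weak closure of \<open>\<Psi>(B_X)\<close>. Condition (2) for the normalisation of \<open>f \<circ> \<Psi>\<close>, with \<open>f\<close> in the dual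
  of \<open>Y\<close>, yields \<open>\<omega>\<close> and \<open>x\<close> with \<open>\<omega> \<Psi>(x)\<close> in the slice \<open>{w \<in> W. Re (f w) > sup Re f(W) - \<delta>}\<close>.
  If the slice has small diameter and consists of points of norm almost \<open>\<parallel>\<Psi>\<parallel>\<close>, then \<open>\<omega> \<Psi>(x)\<close> is close to the
  vector \<open>y\<close> used in (2), and (3) follows.

  Such slices exist in every weakly compact set, without Krein's theorem or denting points of convex hulls, by a
  Baire-type argument in the dual. If no functional near \<open>g\<^sub>0\<close> has small slices, then for each point \<open>c\<close>
  the functionals whose supremum over \<open>W\<close> is not approached near \<open>c\<close> are dense, and so one can construct a
  convergent sequence of functionals \<open>g\<^sub>n\<close> with almost-maximisers \<open>z\<^sub>n\<close> such that the limit \<open>g\<close>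
  does not attain its supremum near the convex hull of the \<open>z\<^sub>n\<close>. But a weak cluster point of \<open>(z\<^sub>n)\<close> is a
  maximiser of \<open>g\<close>, and by Mazur's theorem it lies in the closure of that hull.
\<close>

subsection \<open>The Hahn--Banach theorem\<close>

text \<open>For scaling an inequality is enough: applying it with \<open>inverse t\<close> as well
  gives equality, and the inequality is what passes directly to infima.\<close>

definition sublinear :: "('a::real_vector \<Rightarrow> real) \<Rightarrow> bool" where
  "sublinear p \<longleftrightarrow> (\<forall>x y. p (x + y) \<le> p x + p y) \<and> (\<forall>t>0. \<forall>x. p (t *\<^sub>R x) \<le> t * p x)"

lemma sublinear_zero:
  assumes "sublinear p"
  shows "p 0 = 0"
proof -
  have *: "p (t *\<^sub>R 0) \<le> t * p 0" if "t > 0" for t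
    using assms that unfolding sublinear_def by blast
  \<comment> \<open>The factor 2 forces \<open>p 0\<close> to be nonnegative, the factor 1/2 forces
    it to be nonpositive.\<close>
  show ?thesis using *[of 2] *[of "1/2"] by simp
qed

lemma sublinear_scaleR:
  assumes "sublinear p" "t \<ge> 0"
  shows "p (t *\<^sub>R x) = t * p x"
proof (cases "t = 0")
  case False
  then have t: "t > 0" using assms by simp
  have "p (inverse t *\<^sub>R (t *\<^sub>R x)) \<le> inverse t * p (t *\<^sub>R x)"
    using assms t unfolding sublinear_def by (meson positive_imp_inverse_positive)
  then have "t * p x \<le> p (t *\<^sub>R x)" using t by (simp add: field_simps)
  then show ?thesis using assms t unfolding sublinear_def by (meson order_antisym)
qed (use sublinear_zero[OF assms(1)] in simp)

text \<open>The index \<open>k\<close> may depend on the arguments. This directedness covers chains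
  of functionals as well as the families indexed by a half-line, or by a half-line times a convex
  set, that occur below.\<close>

lemma sublinear_INF:
  fixes f :: "'i \<Rightarrow> 'a::real_vector \<Rightarrow> real"
  assumes ne: "I \<noteq> {}"
    and bdd: "\<And>x. bdd_below ((\<lambda>i. f i x) ` I)"
    and add: "\<And>i j x y. i \<in> I \<Longrightarrow> j \<in> I \<Longrightarrow> \<exists>k\<in>I. f k (x + y) \<le> f i x + f j y"
    and scale: "\<And>i t x. i \<in> I \<Longrightarrow> t > 0 \<Longrightarrow> \<exists>k\<in>I. f k (t *\<^sub>R x) \<le> t * f i x"
  shows "sublinear (\<lambda>x. INF i\<in>I. f i x)"
  unfolding sublinear_def
proof (intro conjI allI impI)
  fix x y
  let ?F = "\<lambda>x. INF i\<in>I. f i x"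
  have *: "?F (x + y) \<le> f i x + f j y" if ij: "i \<in> I" "j \<in> I" for i j
  proof -
    obtain k where k: "k \<in> I" "f k (x + y) \<le> f i x + f j y" using add ij by blast
    then show ?thesis using cINF_lower[OF bdd k(1), of "x+y"] by simp
  qed
  have "?F (x + y) - f j y \<le> ?F x" if "j \<in> I" for j
    by (rule cINF_greatest[OF ne]) (use *[OF _ that] in \<open>simp add: diff_le_eq\<close>)
  then have "?F (x + y) - ?F x \<le> ?F y"
    by (intro cINF_greatest[OF ne]) (simp add: algebra_simps)
  then show "?F (x + y) \<le> ?F x + ?F y" by simp
next
  fix t :: real and x assume t: "t > 0"
  let ?F = "\<lambda>x. INF i\<in>I. f i x"
  have "?F (t *\<^sub>R x) / t \<le> f i x" if i: "i \<in> I" for i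
  proof -
    obtain k where k: "k \<in> I" "f k (t *\<^sub>R x) \<le> t * f i x" using scale i t by blast
    then have "?F (t *\<^sub>R x) \<le> t * f i x" using cINF_lower[OF bdd k(1), of "t *\<^sub>R x"] by simp
    then show ?thesis using t by (simp add: field_simps)
  qed
  then have "?F (t *\<^sub>R x) / t \<le> ?F x" by (intro cINF_greatest[OF ne])
  then show "?F (t *\<^sub>R x) \<le> t * ?F x" using t by (simp add: field_simps)
qed

lemma sublinear_neg_le:
  assumes "sublinear p"
  shows "- p (- x) \<le> p x"
proof -
  have "p (x + - x) \<le> p x + p (- x)" using assms unfolding sublinear_def by blast
  then show ?thesis using sublinear_zero[OF assms] by simp
qed

text \<open>Linear functionals are exactly the minimal sublinear ones, which replaces the extension argument.\<close>

lemma ex_minimal_sublinear: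
  assumes p: "sublinear p"
  obtains q where "sublinear q" "q \<le> p" "\<And>r. sublinear r \<Longrightarrow> r \<le> q \<Longrightarrow> r = q"
proof -
  define A where "A = {q. sublinear q \<and> q \<le> p}"
  \<comment> \<open>The order is reversed, so that the maximal element given by Zorn's lemma is a
    minimal functional.\<close>
  define P where "P = (\<lambda>f g :: 'a \<Rightarrow> real. g \<le> f)"
  have po: "partial_order_on A (relation_of P A)"
    by (rule partial_order_on_relation_ofI) (auto simp: P_def)
  have "\<exists>u\<in>A. \<forall>q\<in>C. P q u" if C: "C \<in> Chains (relation_of P A)" for C
  proof (cases "C = {}")
    case True
    then show ?thesis using p by (auto simp: A_def)
  next
    case False
    have CA: "C \<subseteq> A" and tot: "\<And>f g. f \<in> C \<Longrightarrow> g \<in> C \<Longrightarrow> f \<le> g \<or> g \<le> f"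
      using C by (auto simp: Chains_def relation_of_def P_def)
    \<comment> \<open>This bound is the same for all members of the chain, so their pointwise
      infimum is finite.\<close>
    have low: "- p (- x) \<le> q x" if "q \<in> C" for q x
    proof -
      have "sublinear q" "q (- x) \<le> p (- x)" using that CA by (auto simp: A_def le_fun_def)
      then show ?thesis using sublinear_neg_le[of q x] by simp
    qed
    then have bdd: "bdd_below ((\<lambda>q. q x) ` C)" for x by (auto intro!: bdd_belowI2)
    define u where "u = (\<lambda>x. INF q\<in>C. q x)"
    have "sublinear u" unfolding u_def
    proof (rule sublinear_INF[OF False bdd])
      fix f g x y assume fg: "f \<in> C" "g \<in> C"
      have sub: "h (x + y) \<le> h x + h y" if "h \<in> C" for h
        using that CA by (auto simp: A_def sublinear_def)
      show "\<exists>k\<in>C. k (x + y) \<le> f x + g y"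
      proof (cases "f \<le> g")
        case True
        then show ?thesis using sub[OF fg(1)] fg by (intro bexI[of _ f]) (auto simp: le_fun_def intro: order_trans)
      next
        case False
        then have "g \<le> f" using tot fg by blast
        then show ?thesis using sub[OF fg(2)] fg by (intro bexI[of _ g]) (auto simp: le_fun_def intro: order_trans)
      qed
    next
      fix f t x assume "f \<in> C" "(t::real) > 0"
      then show "\<exists>k\<in>C. k (t *\<^sub>R x) \<le> t * f x"
        using CA by (intro bexI[of _ f]) (auto simp: A_def sublinear_def)
    qed
    moreover have le: "u \<le> q" if "q \<in> C" for q
      unfolding u_def le_fun_def using cINF_lower[OF bdd that] by simp
    moreover have "u \<le> p" using le False CA by (force simp: A_def)
    ultimately show ?thesis by (intro bexI[of _ u]) (auto simp: A_def P_def)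
  qed
  from predicate_Zorn[OF po this] obtain q where
    "q \<in> A" "\<And>r. r \<in> A \<Longrightarrow> P q r \<Longrightarrow> r = q" by blast
  then show thesis
    by (intro that[of q]) (auto simp: A_def P_def)
qed

text \<open>A minimal sublinear \<open>q\<close> below \<open>p\<close> is additive. Lowering
  \<open>q\<close> along a fixed direction \<open>v\<close> gives a sublinear functional below
  \<open>q\<close>, hence \<open>q\<close> itself, and this yields superadditivity in
  \<open>v\<close>.\<close>

theorem Hahn_Banach_sublinear:
  assumes "sublinear p"
  obtains g where "linear g" "\<And>x. g x \<le> p x"
proof -
  obtain q where q: "sublinear q" "q \<le> p" and min: "\<And>r. sublinear r \<Longrightarrow> r \<le> q \<Longrightarrow> r = q"
    using ex_minimal_sublinear[OF assms] by blast
  have sub: "q (x + y) \<le> q x + q y" for x y using q by (auto simp: sublinear_def)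
  have add: "q (x + v) = q x + q v" for x v
  proof -
    \<comment> \<open>The parameter value 0 shows that the infimum over \<open>t\<close> lies below
      \<open>q\<close>. Once it equals \<open>q\<close>, the value 1 gives
      \<open>q x + q v \<le> q (x + v)\<close>.\<close>
    define F where "F = (\<lambda>t y. q (y + t *\<^sub>R v) - t * q v)"
    have bdd: "bdd_below ((\<lambda>t. F t y) ` {0..})" for y
    proof (rule bdd_belowI2)
      fix t :: real assume "t \<in> {0..}"
      then have "t * q v = q (t *\<^sub>R v)" using sublinear_scaleR[OF q(1)] by simp
      also have "\<dots> \<le> q (y + t *\<^sub>R v) + q (- y)" using sub[of "y + t *\<^sub>R v" "- y"] by simp
      finally show "- q (- y) \<le> F t y" by (simp add: F_def)
    qed
    have "sublinear (\<lambda>y. INF t\<in>{0..}. F t y)"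
    proof (rule sublinear_INF[OF _ bdd])
      fix s t :: real and y z assume st: "s \<in> {0..}" "t \<in> {0..}"
      have "q (y + z + (s + t) *\<^sub>R v) \<le> q (y + s *\<^sub>R v) + q (z + t *\<^sub>R v)"
        using sub[of "y + s *\<^sub>R v" "z + t *\<^sub>R v"] by (simp add: algebra_simps)
      then show "\<exists>k\<in>{0..}. F k (y + z) \<le> F s y + F t z"
        using st by (intro bexI[of _ "s + t"]) (auto simp: F_def algebra_simps)
    next
      fix s t :: real and y assume st: "s \<in> {0..}" "t > 0"
      have "q (t *\<^sub>R (y + s *\<^sub>R v)) = t * q (y + s *\<^sub>R v)"
        using sublinear_scaleR[OF q(1)] st by simp
      then show "\<exists>k\<in>{0..}. F k (t *\<^sub>R y) \<le> t * F s y"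
        using st by (intro bexI[of _ "t * s"]) (auto simp: F_def algebra_simps)
    qed auto
    moreover have le: "(INF t\<in>{0..}. F t y) \<le> F s y" if "s \<ge> 0" for s y
      using cINF_lower[OF bdd, of s y] that by simp
    moreover have "(\<lambda>y. INF t\<in>{0..}. F t y) \<le> q"
      using le[of 0] by (simp add: le_fun_def F_def)
    ultimately have "(\<lambda>y. INF t\<in>{0..}. F t y) = q" using min by blast
    then have "q x \<le> F 1 x" using le[of 1 x] by (metis zero_le_one)
    then show ?thesis using sub[of x v] by (simp add: F_def)
  qed
  have "q (- x) = - q x" for x
    using add[of x "- x"] sublinear_zero[OF q(1)] by simp
  then have "q (t *\<^sub>R x) = t * q x" for t x
    using sublinear_scaleR[OF q(1), of t x] sublinear_scaleR[OF q(1), of "- t" x]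
    by (cases "t \<ge> 0") (auto simp: )
  then have "linear q" using add by (intro linearI) auto
  then show thesis using that q(2) by (auto simp: le_fun_def)
qed

text \<open>A linear minorant of the infimum of
  \<open>norm (x + t *\<^sub>R (z - c)) - t * d\<close> over \<open>t \<ge> 0\<close> and
  \<open>c \<in> C\<close> does the job: \<open>t = 0\<close> bounds its norm, and
  \<open>t = 1\<close> at the point \<open>- (z - c)\<close> gives the gap \<open>d\<close>.\<close>

theorem Hahn_Banach_separation:
  fixes z :: "'a::real_normed_vector"
  assumes C: "convex C" "C \<noteq> {}" and d: "\<And>c. c \<in> C \<Longrightarrow> d \<le> norm (z - c)"
  obtains g :: "'a \<Rightarrow>\<^sub>L real" where "norm g \<le> 1" "\<And>c. c \<in> C \<Longrightarrow> blinfun_apply g c + d \<le> blinfun_apply g z"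
proof -
  define F where "F = (\<lambda>(t, c) x. norm (x + t *\<^sub>R (z - c)) - t * d)"
  define I where "I = {0::real..} \<times> C"
  obtain c0 where c0: "c0 \<in> C" using C by blast
  have bdd: "bdd_below ((\<lambda>i. F i x) ` I)" for x
  proof (rule bdd_belowI2)
    fix i assume "i \<in> I"
    then obtain t c where i: "i = (t, c)" "t \<ge> 0" "c \<in> C" by (auto simp: I_def)
    have "t * d \<le> norm (t *\<^sub>R (z - c))" using i d by (simp add: mult_left_mono)
    also have "\<dots> \<le> norm (x + t *\<^sub>R (z - c)) + norm x"
      using norm_triangle_ineq4[of "x + t *\<^sub>R (z - c)" x] by simp
    finally show "- norm x \<le> F i x" by (simp add: F_def i)
  qed
  define p where "p = (\<lambda>x. INF i\<in>I. F i x)"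
  have p_le: "p x \<le> norm (x + t *\<^sub>R (z - c)) - t * d" if "t \<ge> 0" "c \<in> C" for x t c
    unfolding p_def using cINF_lower[OF bdd, of "(t, c)" x] that by (simp add: I_def F_def)
  have "sublinear p" unfolding p_def
  proof (rule sublinear_INF[OF _ bdd])
    show "I \<noteq> {}" using c0 by (auto simp: I_def)
  next
    fix i j x y assume "i \<in> I" "j \<in> I"
    then obtain s a t b where ij: "i = (s, a)" "j = (t, b)" "s \<ge> 0" "t \<ge> 0" "a \<in> C" "b \<in> C"
      by (auto simp: I_def)
    show "\<exists>k\<in>I. F k (x + y) \<le> F i x + F j y"
    proof (cases "s + t = 0")
      case True
      then show ?thesis using ij norm_triangle_ineq[of x y]
        by (intro bexI[of _ i]) (auto simp: F_def I_def add_nonneg_eq_0_iff)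
    next
      case False
      then have pos: "s + t > 0" using ij by linarith
      \<comment> \<open>Convexity enters here: two rays of lengths \<open>s\<close> and
        \<open>t\<close> combine into one of length \<open>s + t\<close> through the weighted mean
        of \<open>a\<close> and \<open>b\<close>. The case of total length 0 has no mean and is
        treated apart.\<close>
      define c where "c = (s / (s + t)) *\<^sub>R a + (t / (s + t)) *\<^sub>R b"
      have "c \<in> C" unfolding c_def using C(1) ij pos
        by (intro convexD) (auto simp: add_divide_distrib[symmetric])
      moreover have "(s + t) *\<^sub>R c = s *\<^sub>R a + t *\<^sub>R b"
        using pos by (simp add: c_def scaleR_add_right)
      then have "x + y + (s + t) *\<^sub>R (z - c) = (x + s *\<^sub>R (z - a)) + (y + t *\<^sub>R (z - b))"
        by (simp add: algebra_simps)
      then have "norm (x + y + (s + t) *\<^sub>R (z - c)) \<le> norm (x + s *\<^sub>R (z - a)) + norm (y + t *\<^sub>R (z - b))"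
        using norm_triangle_ineq by metis
      ultimately show ?thesis using pos ij
        by (intro bexI[of _ "(s + t, c)"]) (auto simp: F_def I_def algebra_simps)
    qed
  next
    fix i and t :: real and x assume "i \<in> I" and t: "t > 0"
    then obtain s c where i: "i = (s, c)" "s \<ge> 0" "c \<in> C" by (auto simp: I_def)
    have "norm (t *\<^sub>R x + (t * s) *\<^sub>R (z - c)) = t * norm (x + s *\<^sub>R (z - c))"
      using t norm_scaleR[of t "x + s *\<^sub>R (z - c)"] by (simp add: scaleR_add_right)
    then show "\<exists>k\<in>I. F k (t *\<^sub>R x) \<le> t * F i x"
      using i t by (intro bexI[of _ "(t * s, c)"]) (auto simp: F_def I_def algebra_simps)
  qed
  then obtain g where g: "linear g" "\<And>x. g x \<le> p x" using Hahn_Banach_sublinear by blast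
  have "g x \<le> norm x" for x using g(2)[of x] p_le[OF _ c0, of 0 x] by simp
  from this[of "- x" for x] this have ng: "\<bar>g x\<bar> \<le> norm x" for x
    using linear_neg[OF g(1)] by (simp add: abs_le_iff)
  interpret linear g by fact
  have bl: "bounded_linear g"
    using ng by unfold_locales (auto intro!: exI[of _ 1])
  show thesis
  proof (rule that[of "Blinfun g"])
    show "norm (Blinfun g) \<le> 1"
      by (rule norm_blinfun_bound) (auto simp: bounded_linear_Blinfun_apply[OF bl] ng)
    fix c assume "c \<in> C"
    then have "g (- (z - c)) \<le> - d"
      using g(2)[of "- (z - c)"] p_le[of 1 c "- (z - c)"] by simp
    then have "g c + d \<le> g z" by (simp add: diff)
    then show "blinfun_apply (Blinfun g) c + d \<le> blinfun_apply (Blinfun g) z"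
      by (simp add: bounded_linear_Blinfun_apply[OF bl])
  qed
qed

text \<open>This is separation of \<open>z\<close> from the origin with gap
  \<open>norm z\<close>.\<close>

corollary ex_norming_functional:
  fixes z :: "'a::real_normed_vector"
  obtains g :: "'a \<Rightarrow>\<^sub>L real" where "norm g \<le> 1" "blinfun_apply g z = norm z"
proof -
  obtain g :: "'a \<Rightarrow>\<^sub>L real" where g: "norm g \<le> 1"
    "\<And>c. c \<in> {0} \<Longrightarrow> blinfun_apply g c + norm z \<le> blinfun_apply g z"
    using Hahn_Banach_separation[of "{0}" "norm z" z] by (metis convex_singleton diff_zero insert_not_empty order_refl singletonD)
  moreover have "blinfun_apply g z \<le> norm z"
    using norm_blinfun[of g z] mult_right_mono[OF g(1), of "norm z"] by auto
  ultimately show thesis using that[of g] by (simp add: blinfun.zero_right)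
qed

subsection \<open>Small slices\<close>

definition support_fun :: "'a::real_normed_vector set \<Rightarrow> ('a \<Rightarrow>\<^sub>L real) \<Rightarrow> real" where
  "support_fun W g = (SUP w\<in>W. blinfun_apply g w)"

text \<open>The centre \<open>c\<close> ranges over the whole space, so if this fails at some
  functional, then one of its slices lies in a single closed ball of radius
  \<open>\<epsilon>\<close>.\<close>

definition large_slices :: "'a::real_normed_vector set \<Rightarrow> real \<Rightarrow> ('a \<Rightarrow>\<^sub>L real) set \<Rightarrow> bool" where
  "large_slices W \<epsilon> U \<longleftrightarrow>
     (\<forall>g\<in>U. \<forall>\<delta>>0. \<forall>c. \<exists>w\<in>W. blinfun_apply g w > support_fun W g - \<delta> \<and> norm (w - c) > \<epsilon>)"

lemma blinfun_apply_le:
  fixes g :: "'a::real_normed_vector \<Rightarrow>\<^sub>L real"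
  assumes "norm g \<le> a" "norm x \<le> b"
  shows "blinfun_apply g x \<le> a * b"
proof -
  have "\<bar>blinfun_apply g x\<bar> \<le> norm g * norm x" using norm_blinfun[of g x] by simp
  also have "\<dots> \<le> a * b" using assms by (intro mult_mono) (auto intro: order_trans[OF norm_ge_zero])
  finally show ?thesis by simp
qed

lemma blinfun_apply_le_add_dist:
  fixes g h :: "'a::real_normed_vector \<Rightarrow>\<^sub>L real"
  assumes "norm w \<le> M"
  shows "blinfun_apply g w \<le> blinfun_apply h w + dist g h * M"
  using blinfun_apply_le[OF order_refl assms, of "g - h"] by (simp add: blinfun.diff_left dist_norm)

context
  fixes W :: "'a::real_normed_vector set" and M :: real
  assumes W_ne: "W \<noteq> {}" and W_le: "\<And>w. w \<in> W \<Longrightarrow> norm w \<le> M" and M: "M > 0"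
begin

lemma bdd_above_blinfun_image:
  fixes g :: "'a \<Rightarrow>\<^sub>L real"
  shows "bdd_above ((\<lambda>w. blinfun_apply g w) ` W)"
  using blinfun_apply_le[OF order_refl W_le, of _ g] by (intro bdd_aboveI2)

lemma le_support_fun: "w \<in> W \<Longrightarrow> blinfun_apply g w \<le> support_fun W g"
  unfolding support_fun_def by (rule cSUP_upper[OF _ bdd_above_blinfun_image])

lemma support_fun_le: "(\<And>w. w \<in> W \<Longrightarrow> blinfun_apply g w \<le> c) \<Longrightarrow> support_fun W g \<le> c"
  unfolding support_fun_def by (rule cSUP_least[OF W_ne])

lemma ex_gt_support_fun:
  assumes "\<delta> > 0"
  shows "\<exists>w\<in>W. blinfun_apply g w > support_fun W g - \<delta>"
  using support_fun_le[of g "support_fun W g - \<delta>"] assms by force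

lemma support_fun_le_add_dist: "support_fun W g \<le> support_fun W h + dist g h * M"
proof (rule support_fun_le)
  fix w assume "w \<in> W"
  then show "blinfun_apply g w \<le> support_fun W h + dist g h * M"
    using blinfun_apply_le_add_dist[OF W_le, of w g h] le_support_fun[of w h] by simp
qed

text \<open>Since slices of \<open>g1\<close> are large, some almost-maximiser \<open>w\<close> is
  further than \<open>\<epsilon>\<close> from \<open>c\<close>. Tilting \<open>g1\<close> by a
  functional that norms \<open>w - c\<close> favours \<open>w\<close> over all points within
  \<open>\<epsilon> / 2\<close> of \<open>c\<close>, and the resulting margin survives on a small
  ball of functionals.\<close>

lemma large_slices_avoid_cball:
  assumes large: "large_slices W \<epsilon> (ball g0 r)" and eps: "\<epsilon> > 0"
    and r1: "r1 > 0" "cball g1 r1 \<subseteq> ball g0 r"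
  shows "\<exists>g2 r2. r2 > 0 \<and> cball g2 r2 \<subseteq> cball g1 r1 \<and>
    (\<forall>g\<in>cball g2 r2. \<forall>w\<in>W \<inter> cball c (\<epsilon> / 2). blinfun_apply g w < support_fun W g)"
proof -
  \<comment> \<open>Half of \<open>r1\<close> is spent on the tilt and half is left for the radius
    of the new ball. The slice depth \<open>\<delta>\<close> is half of the advantage
    \<open>t * \<epsilon> / 2\<close> gained by the tilt.\<close>
  define t where "t = r1 / 2"
  define \<delta> where "\<delta> = t * \<epsilon> / 4"
  have t: "t > 0" and d: "\<delta> > 0" using r1 eps by (auto simp: t_def \<delta>_def)
  have "g1 \<in> cball g1 r1" using r1(1) by simp
  then have "g1 \<in> ball g0 r" using r1(2) by blast
  then obtain w where w: "w \<in> W" "blinfun_apply g1 w > support_fun W g1 - \<delta>" "norm (w - c) > \<epsilon>"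
    using large d unfolding large_slices_def by blast
  obtain u :: "'a \<Rightarrow>\<^sub>L real" where u: "norm u \<le> 1" "blinfun_apply u (w - c) = norm (w - c)"
    using ex_norming_functional by blast
  define g2 where "g2 = g1 + t *\<^sub>R u"
  have g2: "dist g2 g1 \<le> t" using t u by (simp add: g2_def dist_norm)
  have "blinfun_apply g2 w \<le> support_fun W g2" using le_support_fun w by blast
  then have lower: "support_fun W g1 - \<delta> + t * (blinfun_apply u c + \<epsilon>) < support_fun W g2"
  proof -
    have "t * (blinfun_apply u c + \<epsilon>) < t * blinfun_apply u w"
      using u w t by (simp add: blinfun.diff_right)
    then show ?thesis using \<open>blinfun_apply g2 w \<le> _\<close> w
      by (simp add: g2_def blinfun.add_left blinfun.scaleR_left)
  qed
  \<comment> \<open>The term \<open>2 * \<delta>\<close> is the advantage of \<open>w\<close> over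
    \<open>v\<close> under the tilt; the term \<open>\<delta>\<close> is what \<open>w\<close> may
    fall short of the supremum of \<open>g1\<close>. A margin of \<open>\<delta>\<close>
    remains.\<close>
  have upper: "blinfun_apply g2 v \<le> support_fun W g2 - 2 * \<delta> + \<delta>" if v: "v \<in> W" "dist c v \<le> \<epsilon> / 2" for v
  proof -
    have "blinfun_apply u (v - c) \<le> 1 * (\<epsilon> / 2)"
      using v by (intro blinfun_apply_le u) (simp add: dist_norm norm_minus_commute)
    then have "t * blinfun_apply u v \<le> t * (blinfun_apply u c + \<epsilon> / 2)"
      using t by (simp add: blinfun.diff_right)
    moreover have "blinfun_apply g1 v \<le> support_fun W g1" using le_support_fun v by blast
    ultimately have "blinfun_apply g2 v \<le> support_fun W g1 + t * (blinfun_apply u c + \<epsilon> / 2)"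
      by (simp add: g2_def blinfun.add_left blinfun.scaleR_left)
    then show ?thesis using lower by (simp add: \<delta>_def algebra_simps)
  qed
  \<comment> \<open>Moving from \<open>g2\<close> to a functional in the new ball changes the value
    at \<open>v\<close> and the support function by at most \<open>\<delta> / 4\<close> each, which
    is less than the margin.\<close>
  define r2 where "r2 = min t (\<delta> / (4 * M))"
  have r2: "r2 > 0" "r2 \<le> t" "r2 * M \<le> \<delta> / 4"
  proof -
    have "r2 \<le> \<delta> / (4 * M)" by (simp add: r2_def)
    then show "r2 * M \<le> \<delta> / 4" using M by (simp add: field_simps)
  qed (use t d M in \<open>auto simp: r2_def\<close>)
  show ?thesis
  proof (intro exI[of _ g2] exI[of _ r2] conjI ballI)
    show "cball g2 r2 \<subseteq> cball g1 r1"
    proof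
      fix g assume "g \<in> cball g2 r2"
      then have "dist g2 g \<le> t" using r2 by simp
      then show "g \<in> cball g1 r1" using g2 dist_triangle[of g1 g g2] by (simp add: t_def dist_commute)
    qed
    fix g v assume g: "g \<in> cball g2 r2" and v: "v \<in> W \<inter> cball c (\<epsilon> / 2)"
    have "dist g2 g * M \<le> r2 * M" using g M by (intro mult_right_mono) auto
    then have "dist g2 g * M \<le> \<delta> / 4" using r2 by simp
    then show "blinfun_apply g v < support_fun W g"
      using blinfun_apply_le_add_dist[OF W_le, of v g g2] support_fun_le_add_dist[of g2 g]
        upper[of v] v d by (auto simp: dist_commute)
  qed (use r2 in auto)
qed

lemma large_slices_avoid_finite:
  assumes large: "large_slices W \<epsilon> (ball g0 r)" and eps: "\<epsilon> > 0" and "finite C"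
    and r1: "r1 > 0" "cball g1 r1 \<subseteq> ball g0 r"
  shows "\<exists>g2 r2. r2 > 0 \<and> cball g2 r2 \<subseteq> cball g1 r1 \<and>
    (\<forall>g\<in>cball g2 r2. \<forall>c\<in>C. \<forall>w\<in>W \<inter> cball c (\<epsilon> / 2). blinfun_apply g w < support_fun W g)"
  using \<open>finite C\<close>
proof (induction C)
  case empty
  then show ?case using r1 by (intro exI[of _ g1] exI[of _ r1]) auto
next
  case (insert c C)
  then obtain g2 r2 where g2: "r2 > 0" "cball g2 r2 \<subseteq> cball g1 r1"
    "\<forall>g\<in>cball g2 r2. \<forall>c\<in>C. \<forall>w\<in>W \<inter> cball c (\<epsilon> / 2). blinfun_apply g w < support_fun W g" by blast
  obtain g3 r3 where g3: "r3 > 0" "cball g3 r3 \<subseteq> cball g2 r2"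
    "\<forall>g\<in>cball g3 r3. \<forall>w\<in>W \<inter> cball c (\<epsilon> / 2). blinfun_apply g w < support_fun W g"
    using large_slices_avoid_cball[OF large eps g2(1), of g2 c] g2(2) r1(2) by blast
  show ?case
  proof (intro exI conjI ballI)
    show "r3 > 0" by fact
    show "cball g3 r3 \<subseteq> cball g1 r1" using g2 g3 by blast
    fix g d v assume "g \<in> cball g3 r3" "d \<in> insert c C" "v \<in> W \<inter> cball d (\<epsilon> / 2)"
    then show "blinfun_apply g v < support_fun W g" using g2(3) g3(2,3) by blast
  qed
qed

text \<open>The hull of a finite set is compact, so it has a finite net of mesh
  \<open>\<epsilon> / 4\<close>. Avoiding radius \<open>\<epsilon> / 2\<close> around the net avoids
  radius \<open>\<epsilon> / 4\<close> around the hull. The point \<open>z\<close> is chosen for the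
  centre \<open>g2\<close> and stays almost maximal for all functionals in a smaller ball.\<close>

lemma large_slices_step:
  assumes large: "large_slices W \<epsilon> (ball g0 r)" and eps: "\<epsilon> > 0"
    and r1: "r1 > 0" "cball g1 r1 \<subseteq> ball g0 r" and S: "finite S" and \<eta>: "\<eta> > 0"
  shows "\<exists>g2 r2 z. r2 > 0 \<and> r2 \<le> \<eta> \<and> cball g2 r2 \<subseteq> cball g1 r1 \<and> z \<in> W \<and>
    (\<forall>g\<in>cball g2 r2. support_fun W g - \<eta> \<le> blinfun_apply g z \<and>
       (\<forall>c\<in>convex hull S. \<forall>w\<in>W \<inter> cball c (\<epsilon> / 4). blinfun_apply g w < support_fun W g))"
proof -
  have "compact (convex hull S)" using finite_imp_compact_convex_hull[OF S] .
  then obtain C where C: "finite C" "convex hull S \<subseteq> (\<Union>x\<in>C. ball x (\<epsilon> / 4))"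
    using eps compact_imp_seq_compact seq_compact_imp_totally_bounded by (metis zero_less_divide_iff zero_less_numeral)
  obtain g2 s where g2: "s > 0" "cball g2 s \<subseteq> cball g1 r1"
    "\<forall>g\<in>cball g2 s. \<forall>c\<in>C. \<forall>w\<in>W \<inter> cball c (\<epsilon> / 2). blinfun_apply g w < support_fun W g"
    using large_slices_avoid_finite[OF large eps C(1) r1] by blast
  obtain z where z: "z \<in> W" "blinfun_apply g2 z > support_fun W g2 - \<eta> / 2"
    using ex_gt_support_fun \<eta> half_gt_zero by blast
  define r2 where "r2 = min s (min \<eta> (\<eta> / (4 * M)))"
  have r2: "r2 > 0" "r2 \<le> s" "r2 \<le> \<eta>" "r2 * M \<le> \<eta> / 4"
  proof -
    have "r2 \<le> \<eta> / (4 * M)" by (simp add: r2_def)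
    then show "r2 * M \<le> \<eta> / 4" using M by (simp add: field_simps)
  qed (use g2 \<eta> M in \<open>auto simp: r2_def\<close>)
  show ?thesis
  proof (intro exI[of _ g2] exI[of _ r2] exI[of _ z] conjI ballI)
    show "cball g2 r2 \<subseteq> cball g1 r1" using g2 r2 by auto
    fix g assume g: "g \<in> cball g2 r2"
    have "dist g2 g * M \<le> r2 * M" using g M by (intro mult_right_mono) auto
    then have "dist g2 g * M \<le> \<eta> / 4" using r2 by simp
    then show "support_fun W g - \<eta> \<le> blinfun_apply g z"
      using blinfun_apply_le_add_dist[OF W_le[OF z(1)], of g2 g] support_fun_le_add_dist[of g g2] z
      by (simp add: dist_commute)
    fix c w assume c: "c \<in> convex hull S" and w: "w \<in> W \<inter> cball c (\<epsilon> / 4)"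
    then obtain d where d: "d \<in> C" "dist d c < \<epsilon> / 4" using C(2) by (force)
    then have "w \<in> W \<inter> cball d (\<epsilon> / 2)" using w dist_triangle[of d w c] by auto
    moreover have "g \<in> cball g2 s" using g r2 by auto
    ultimately show "blinfun_apply g w < support_fun W g" using g2(3) d by blast
  qed (use r2 z in auto)
qed

text \<open>Weak compactness of \<open>W\<close> enters only through the existence of weak cluster points of sequences.\<close>

theorem ex_small_slice:
  assumes cluster: "\<And>z :: nat \<Rightarrow> 'a. range z \<subseteq> W \<Longrightarrow>
      \<exists>w\<in>W. \<forall>g :: 'a \<Rightarrow>\<^sub>L real. \<forall>N c. (\<forall>n\<ge>N. blinfun_apply g (z n) \<le> c) \<longrightarrow> blinfun_apply g w \<le> c"
    and eps: "\<epsilon> > 0" and r: "r > 0"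
  obtains g \<delta> c where "dist g0 g < r" "\<delta> > 0"
    "\<And>w. w \<in> W \<Longrightarrow> support_fun W g - \<delta> < blinfun_apply g w \<Longrightarrow> norm (w - c) \<le> \<epsilon>"
proof -
  have "\<not> large_slices W \<epsilon> (ball g0 r)"
  proof
    assume large: "large_slices W \<epsilon> (ball g0 r)"
    \<comment> \<open>A state consists of the centre and radius of a ball of functionals, the finite
      set of points chosen so far, and the last point chosen.\<close>
    define P where "P = (\<lambda>(g1, r1, S::'a set, z::'a). r1 > 0 \<and> cball g1 r1 \<subseteq> ball g0 r \<and> finite S)"
    define Q where "Q = (\<lambda>n (g1, r1, S::'a set, z::'a) (g2, r2, S', z'). r2 \<le> inverse (real (Suc n)) \<and> cball g2 r2 \<subseteq> cball g1 r1 \<and>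
        S' = insert z' S \<and> z' \<in> W \<and>
        (\<forall>g\<in>cball g2 r2. support_fun W g - inverse (real (Suc n)) \<le> blinfun_apply g z' \<and>
        (\<forall>c\<in>convex hull S. \<forall>w\<in>W \<inter> cball c (\<epsilon> / 4). blinfun_apply g w < support_fun W g)))"
    have "\<exists>f. \<forall>n. P (f n) \<and> Q n (f n) (f (Suc n))"
    proof (rule dependent_nat_choice)
      have "cball g0 (r / 2) \<subseteq> ball g0 r" using r by auto
      \<comment> \<open>The initial point 0 is a placeholder that need not lie in \<open>W\<close>.
        It never enters the finite sets, and only the points \<open>z (Suc n)\<close> are used
        later.\<close>
      then have "P (g0, r / 2, {}, 0)" using r by (simp add: P_def)
      then show "\<exists>x. P x" by blast
    next
      fix x n assume "P x"
      then obtain g1 r1 S z where x: "x = (g1, r1, S, z)" and px: "r1 > 0" "cball g1 r1 \<subseteq> ball g0 r" "finite S"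
        by (auto simp: P_def)
      obtain g2 r2 z' where s: "r2 > 0" "r2 \<le> inverse (real (Suc n))" "cball g2 r2 \<subseteq> cball g1 r1" "z' \<in> W"
        "\<forall>g\<in>cball g2 r2. support_fun W g - inverse (real (Suc n)) \<le> blinfun_apply g z' \<and>
          (\<forall>c\<in>convex hull S. \<forall>w\<in>W \<inter> cball c (\<epsilon> / 4). blinfun_apply g w < support_fun W g)"
        using large_slices_step[OF large eps px, of "inverse (real (Suc n))"] by auto
      show "\<exists>y. P y \<and> Q n x y"
        by (rule exI[of _ "(g2, r2, insert z' S, z')"]) (use s px in \<open>auto simp: P_def Q_def x\<close>)
    qed
    then obtain f where f: "\<And>n. P (f n)" "\<And>n. Q n (f n) (f (Suc n))" by blast
    define G where "G = (\<lambda>n. fst (f n))"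
    define R where "R = (\<lambda>n. fst (snd (f n)))"
    define S where "S = (\<lambda>n. fst (snd (snd (f n))))"
    define z where "z = (\<lambda>n. snd (snd (snd (f n))))"
    have fn: "f n = (G n, R n, S n, z n)" for n by (simp add: G_def R_def S_def z_def)
    have Rpos: "R n > 0" for n using f(1)[of n] by (simp add: P_def fn)
    note Q = f(2)[unfolded fn Q_def prod.case]
    have R_le: "R (Suc n) \<le> inverse (real (Suc n))" for n using Q by blast
    have nest: "cball (G (Suc n)) (R (Suc n)) \<subseteq> cball (G n) (R n)" for n using Q by blast
    have S_Suc: "S (Suc n) = insert (z (Suc n)) (S n)" for n using Q by blast
    have zW: "z (Suc n) \<in> W" for n using Q by blast
    \<comment> \<open>The dual is complete and the radii tend to 0, so the nested balls have a
      common point.\<close>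
    obtain g where g: "\<And>n. g \<in> cball (G n) (R n)"
    proof (rule decreasing_closed_nest[of "\<lambda>n. cball (G n) (R n)"])
      show "closed (cball (G n) (R n))" for n by simp
      show "cball (G n) (R n) \<noteq> {}" for n using Rpos[of n] by simp
      show "cball (G n) (R n) \<subseteq> cball (G m) (R m)" if "m \<le> n" for m n
        using nest that by (rule lift_Suc_antimono_le)
      show "\<exists>n. \<forall>x\<in>cball (G n) (R n). \<forall>y\<in>cball (G n) (R n). dist x y < e" if "e > 0" for e
      proof -
        obtain n where n: "inverse (real (Suc n)) < e / 2"
          using reals_Archimedean \<open>e > 0\<close> half_gt_zero by blast
        show ?thesis
        proof (intro exI[of _ "Suc n"] ballI)
          fix x y assume "x \<in> cball (G (Suc n)) (R (Suc n))" "y \<in> cball (G (Suc n)) (R (Suc n))"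
          then show "dist x y < e"
            using R_le[of n] n dist_triangle[of x y "G (Suc n)"] by (simp add: dist_commute)
        qed
      qed
    qed (use that in blast)
    have gz: "support_fun W g - inverse (real (Suc n)) \<le> blinfun_apply g (z (Suc n))" for n
      using Q g by blast
    have avoid: "blinfun_apply g w < support_fun W g"
      if "c \<in> convex hull S n" "w \<in> W" "dist c w \<le> \<epsilon> / 4" for c w n
      using Q[of n] g[of "Suc n"] that by auto
    obtain w where w: "w \<in> W" "\<And>h :: 'a \<Rightarrow>\<^sub>L real. \<And>N c. (\<And>n. n \<ge> N \<Longrightarrow> blinfun_apply h (z (Suc n)) \<le> c) \<Longrightarrow> blinfun_apply h w \<le> c"
    proof -
      have "range (\<lambda>n. z (Suc n)) \<subseteq> W" using zW by auto
      from cluster[OF this] obtain w where "w \<in> W" and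
        w: "\<forall>g :: 'a \<Rightarrow>\<^sub>L real. \<forall>N c. (\<forall>n\<ge>N. blinfun_apply g (z (Suc n)) \<le> c) \<longrightarrow> blinfun_apply g w \<le> c"
        by (elim bexE)
      show thesis
      proof (rule that)
        fix h :: "'a \<Rightarrow>\<^sub>L real" and N c
        assume le: "\<And>n. n \<ge> N \<Longrightarrow> blinfun_apply h (z (Suc n)) \<le> c"
        show "blinfun_apply h w \<le> c" by (rule w[rule_format]) (rule le)
      qed fact
    qed
    have gw: "support_fun W g \<le> blinfun_apply g w"
    proof (rule field_le_epsilon)
      fix e :: real assume "e > 0"
      then obtain N where N: "inverse (real (Suc N)) < e" using reals_Archimedean by blast
      \<comment> \<open>The cluster property transfers upper bounds only, so the lower bound for
        \<open>g\<close> is transferred as an upper bound for \<open>- g\<close>.\<close>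
      have "blinfun_apply (- g) w \<le> - (support_fun W g - e)"
      proof (rule w(2)[of N])
        fix n assume "n \<ge> N"
        then have "inverse (real (Suc n)) \<le> inverse (real (Suc N))" by (intro le_imp_inverse_le) auto
        then have "support_fun W g - e \<le> blinfun_apply g (z (Suc n))" using N gz[of n] by linarith
        then show "blinfun_apply (- g) (z (Suc n)) \<le> - (support_fun W g - e)"
          by (simp add: blinfun.minus_left)
      qed
      then show "support_fun W g \<le> blinfun_apply g w + e" by (simp add: blinfun.minus_left)
    qed
    \<comment> \<open>The union of the increasing hulls is the convex hull of all points
      \<open>z (Suc n)\<close>.\<close>
    define C where "C = (\<Union>n. convex hull S (Suc n))"
    have mono: "convex hull S (Suc m) \<subseteq> convex hull S (Suc n)" if "m \<le> n" for m n
    proof (rule hull_mono)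
      show "S (Suc m) \<subseteq> S (Suc n)"
        by (rule lift_Suc_mono_le[of S]) (use that in \<open>auto simp: S_Suc\<close>)
    qed
    have "convex C"
      unfolding C_def
    proof (rule convexI)
      fix x y u v assume xy: "x \<in> (\<Union>n. convex hull S (Suc n))" "y \<in> (\<Union>n. convex hull S (Suc n))"
        and uv: "(0::real) \<le> u" "0 \<le> v" "u + v = 1"
      obtain m n where "x \<in> convex hull S (Suc m)" "y \<in> convex hull S (Suc n)" using xy by blast
      then have "x \<in> convex hull S (Suc (max m n))" "y \<in> convex hull S (Suc (max m n))"
        using mono[of m "max m n"] mono[of n "max m n"] by auto
      then have "u *\<^sub>R x + v *\<^sub>R y \<in> convex hull S (Suc (max m n))"
        using uv by (intro convexD[OF convex_convex_hull])
      then show "u *\<^sub>R x + v *\<^sub>R y \<in> (\<Union>n. convex hull S (Suc n))" by blast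
    qed
    have zC: "z (Suc n) \<in> C" for n
      unfolding C_def using hull_subset[of "S (Suc n)" convex] S_Suc[of n] by blast
    \<comment> \<open>This is Mazur's argument: a functional separating \<open>w\<close> from
      \<open>C\<close> with a gap would bound its values at all \<open>z (Suc n)\<close> away from
      its value at \<open>w\<close>, against the cluster property.\<close>
    have "\<exists>c\<in>C. norm (w - c) < \<epsilon> / 4"
    proof (rule ccontr)
      assume "\<not> ?thesis"
      then have far: "\<epsilon> / 4 \<le> norm (w - c)" if "c \<in> C" for c
        using that by (meson not_le_imp_less)
      have "C \<noteq> {}" using zC[of 0] by blast
      from Hahn_Banach_separation[OF \<open>convex C\<close> this far]
      obtain h :: "'a \<Rightarrow>\<^sub>L real" where h: "\<And>c. c \<in> C \<Longrightarrow> blinfun_apply h c + \<epsilon> / 4 \<le> blinfun_apply h w"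
        by blast
      have "blinfun_apply h w \<le> blinfun_apply h w - \<epsilon> / 4"
        by (rule w(2)[of 0]) (use h[OF zC] in \<open>simp add: le_diff_eq\<close>)
      then show False using eps by simp
    qed
    then obtain c n where "c \<in> convex hull S (Suc n)" "norm (w - c) < \<epsilon> / 4" unfolding C_def by blast
    \<comment> \<open>The point \<open>c\<close> lies in the hull of one finite stage, so
      \<open>w\<close> is among the points where the next ball forbids \<open>g\<close> to attain
      its supremum; but \<open>w\<close> is a maximiser.\<close>
    then show False using avoid[of c "Suc n" w] w(1) gw by (simp add: dist_norm norm_minus_commute)
  qed
  then obtain g \<delta> c where g: "g \<in> ball g0 r" "\<delta> > 0"
    and small: "\<not> (\<exists>w\<in>W. blinfun_apply g w > support_fun W g - \<delta> \<and> norm (w - c) > \<epsilon>)"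
    unfolding large_slices_def by blast
  show thesis
  proof (rule that)
    show "norm (w - c) \<le> \<epsilon>" if "w \<in> W" "support_fun W g - \<delta> < blinfun_apply g w" for w
      using small that by (meson not_le_imp_less)
  qed (use g in auto)
qed

end

subsection \<open>Scalars, dual space and weak topology\<close>

lemma to_complex_one [simp]: "to_complex (1 :: 'k::real_or_complex) = 1"
  using to_complex_of_real[of 1, where 'k='k] by simp

lemma re_of_real [simp]: "re (of_real r :: 'k::real_or_complex) = r"
  by (simp add: re_def to_complex_of_real)

lemma re_le_norm: "re z \<le> norm z"
  unfolding re_def using complex_Re_le_cmod[of "to_complex z"] by (simp add: norm_to_complex)

lemma bounded_linear_to_complex: "bounded_linear (to_complex :: 'k::real_or_complex \<Rightarrow> complex)"
  by (rule bounded_linear_intro[of _ 1])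
    (auto simp: to_complex_add to_complex_scaleR norm_to_complex)

lemma bounded_linear_re: "bounded_linear (re :: 'k::real_or_complex \<Rightarrow> real)"
  unfolding re_def[abs_def] by (rule bounded_linear_compose[OF bounded_linear_Re bounded_linear_to_complex])

lemma continuous_on_re [continuous_intros]:
  "continuous_on S f \<Longrightarrow> continuous_on S (\<lambda>x. re (f x :: 'k::real_or_complex))"
  by (rule bounded_linear.continuous_on[OF bounded_linear_re])

lemma ex_unimodular:
  obtains \<omega> :: "'k::real_or_complex" where "norm \<omega> = 1" "\<omega> * z = of_real (norm z)"
proof (cases "z = 0")
  case True
  then show thesis using that[of 1] by simp
next
  case False
  then show thesis using that[of "of_real (norm z) / z"] by (simp add: norm_divide)
qed

text \<open>Compactness is pulled back from the complex plane, since \<open>to_complex\<close> is an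
  isometry with closed range.\<close>

lemma compact_cball_real_or_complex: "compact (cball (0 :: 'k::real_or_complex) r)"
proof -
  let ?tc = "to_complex :: 'k \<Rightarrow> complex"
  have "closed (range ?tc)" using range_to_complex[where 'k='k] by (auto simp: closed_complex_Reals)
  then have "compact (cball 0 r \<inter> range ?tc)" by (intro compact_Int_closed) auto
  moreover have "continuous_on (cball 0 r \<inter> range ?tc) (inv ?tc)"
    unfolding continuous_on_iff
  proof (intro ballI allI impI)
    fix x and e :: real assume x: "x \<in> cball 0 r \<inter> range ?tc" and e: "e > 0"
    have dist: "dist (inv ?tc u) (inv ?tc v) = dist u v" if uv: "u \<in> range ?tc" "v \<in> range ?tc" for u v
    proof -
      obtain a b where "u = ?tc a" "v = ?tc b" using uv by blast
      moreover have "?tc a - ?tc b = ?tc (a - b)"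
        using bounded_linear.linear[OF bounded_linear_to_complex] linear_diff by metis
      ultimately show ?thesis by (simp add: inj_to_complex dist_norm norm_to_complex)
    qed
    show "\<exists>d>0. \<forall>x'\<in>cball 0 r \<inter> range ?tc. dist x' x < d \<longrightarrow> dist (inv ?tc x') (inv ?tc x) < e"
      using dist x e by (intro exI[of _ e]) auto
  qed
  ultimately have "compact (inv ?tc ` (cball 0 r \<inter> range ?tc))" by (rule compact_continuous_image[rotated])
  also have "inv ?tc ` (cball 0 r \<inter> range ?tc) = cball 0 r"
  proof (intro equalityI subsetI)
    fix x :: 'k assume "x \<in> cball 0 r"
    then show "x \<in> inv ?tc ` (cball 0 r \<inter> range ?tc)"
      by (intro image_eqI[of _ _ "?tc x"]) (auto simp: inj_to_complex norm_to_complex)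
  qed (auto simp: inj_to_complex norm_to_complex)
  finally show ?thesis .
qed

context banach_space_over
begin

lemma smul_scaleR: "smul c (r *\<^sub>R x) = r *\<^sub>R smul c x"
  using scale_left_commute[of c "of_real r" x] by (simp only: scale_of_real)

lemma bounded_linear_smul: "bounded_linear (smul c)"
  by (rule bounded_linear_intro[of _ "norm c"])
    (auto simp: scale_right_distrib smul_scaleR norm_scale mult.commute)

lemma bounded_linear_smul_left: "bounded_linear (\<lambda>c. smul c x)"
proof (rule bounded_linear_intro[of _ "norm x"])
  fix r and c :: 'k
  have "smul (of_real r * c) x = r *\<^sub>R smul c x"
    using scale_of_real[of r "smul c x"] by simp
  then show "smul (r *\<^sub>R c) x = r *\<^sub>R smul c x" by (simp add: scaleR_conv_of_real)
qed (auto simp: scale_left_distrib norm_scale)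

text \<open>This lets the real separation theorems speak about \<open>dual smul\<close>. Over the
  reals \<open>g\<close> itself serves; over the complex numbers the usual choice is
  \<open>g y - i * g (i y)\<close>, whose real part is \<open>g\<close>.\<close>

lemma ex_dual_re:
  fixes g :: "'a \<Rightarrow>\<^sub>L real"
  obtains f where "f \<in> dual smul" "\<And>y. re (f y) = blinfun_apply g y"
proof (cases "range (to_complex :: 'k \<Rightarrow> complex) = \<real>")
  case True
  define f where "f = (\<lambda>y. of_real (blinfun_apply g y) :: 'k)"
  have "f (smul c y) = c * f y" for c y
  proof -
    have "to_complex c \<in> \<real>" using True by blast
    then obtain r where "to_complex c = complex_of_real r" by (auto elim: Reals_cases)
    then have "c = of_real r" by (metis inj_to_complex injD to_complex_of_real)
    then show ?thesis by (simp add: f_def scale_of_real blinfun.scaleR_right)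
  qed
  moreover have "bounded_linear f" unfolding f_def
    by (rule bounded_linear_compose[OF bounded_linear_of_real blinfun.bounded_linear_right])
  ultimately show thesis by (intro that[of f]) (auto simp: dual_def f_def)
next
  case False
  then have UN: "range (to_complex :: 'k \<Rightarrow> complex) = UNIV" using range_to_complex by blast
  then obtain i :: 'k where i: "to_complex i = \<i>" by (metis UNIV_I imageE)
  have eqI: "a = b" if "to_complex a = to_complex b" for a b :: 'k
    using that inj_to_complex by (rule injD[rotated])
  have ii: "i * i = -1"
  proof (rule eqI)
    have "to_complex (-1 :: 'k) = -1" using to_complex_of_real[of "-1", where 'k='k] by simp
    then show "to_complex (i * i) = to_complex (-1 :: 'k)" by (simp add: to_complex_mult i)
  qed
  define f where "f = (\<lambda>y. of_real (blinfun_apply g y) + (- i) * of_real (blinfun_apply g (smul i y)))"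
  have "f (smul c y) = c * f y" for c y
  proof -
    define a b where "a = Re (to_complex c)" and "b = Im (to_complex c)"
    have c: "c = of_real a + of_real b * i"
      by (rule eqI) (simp add: to_complex_add to_complex_mult to_complex_of_real i a_def b_def complex_eq_iff)
    have 1: "smul c y = a *\<^sub>R y + b *\<^sub>R smul i y"
      unfolding c by (simp add: scale_left_distrib scale_of_real flip: scale_scale)
    have 2: "smul (i * i) y = - y" by (simp add: ii)
    have "smul i (smul c y) = a *\<^sub>R smul i y - b *\<^sub>R y"
      unfolding 1 by (simp add: scale_right_distrib smul_scaleR 2 del: mult_minus1)
    then have "f (smul c y) = of_real (a * blinfun_apply g y + b * blinfun_apply g (smul i y))
        - i * of_real (a * blinfun_apply g (smul i y) - b * blinfun_apply g y)"
      by (simp add: f_def 1 blinfun.bilinear_simps)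
    moreover have "c * f y = of_real a * of_real (blinfun_apply g y) + of_real b * i * of_real (blinfun_apply g y)
       - of_real a * i * of_real (blinfun_apply g (smul i y)) - (i * i) * of_real b * of_real (blinfun_apply g (smul i y))"
      unfolding c f_def by (simp add: algebra_simps)
    ultimately show ?thesis by (simp add: ii right_diff_distrib ac_simps)
  qed
  moreover have "bounded_linear f" unfolding f_def
    by (intro bounded_linear_add bounded_linear_const_mult
        bounded_linear_compose[OF bounded_linear_of_real]
        bounded_linear_compose[OF blinfun.bounded_linear_right] bounded_linear_smul
        blinfun.bounded_linear_right)
  moreover have "re (f y) = blinfun_apply g y" for y
  proof -
    have "to_complex (f y) = of_real (blinfun_apply g y) + to_complex (- i) * of_real (blinfun_apply g (smul i y))"
      unfolding f_def by (simp only: to_complex_add to_complex_mult to_complex_of_real)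
    moreover have "to_complex (- i) = - \<i>"
      using linear_neg[OF bounded_linear.linear[OF bounded_linear_to_complex], of i] i by simp
    ultimately show ?thesis by (simp add: re_def)
  qed
  ultimately show thesis by (intro that[of f]) (auto simp: dual_def)
qed

section \<open>The weak topology: closed convex sets, compact sets and cluster points\<close>

lemma topspace_weak_topology [simp]: "topspace (weak_topology smul) = UNIV"
proof -
  have "(\<lambda>_. 0) \<in> dual smul" by (simp add: dual_def)
  then have "(\<lambda>_. 0) -` UNIV \<in> {f -` U |f U. f \<in> dual smul \<and> open U}" by blast
  then show ?thesis unfolding weak_topology_def topology_generated_by_topspace by auto
qed

lemma openin_weak_vimage: "f \<in> dual smul \<Longrightarrow> open U \<Longrightarrow> openin (weak_topology smul) (f -` U)"
  unfolding weak_topology_def by (rule topology_generated_by_Basis) blast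

lemma closedin_weak_vimage: "f \<in> dual smul \<Longrightarrow> closed U \<Longrightarrow> closedin (weak_topology smul) (f -` U)"
  using openin_weak_vimage[of f "- U"] by (simp add: closedin_def vimage_Compl open_Compl flip: Compl_eq_Diff_UNIV)

lemma openin_weak_imp_open:
  assumes "openin (weak_topology smul) U"
  shows "open U"
proof -
  have "generate_topology_on {f -` U |f U. f \<in> dual smul \<and> open U} U"
    using assms unfolding weak_topology_def openin_topology_generated_by_iff .
  then show ?thesis
  proof induction
    case (Basis V)
    then obtain f O' where "f \<in> dual smul" "open O'" "V = f -` O'" by blast
    then show ?case by (auto simp: dual_def intro!: open_vimage linear_continuous_on)
  qed auto
qed

lemma compactin_weak_of_compact:
  assumes "compact K"
  shows "compactin (weak_topology smul) K"
  unfolding compactin_def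
proof (intro conjI allI impI)
  fix \<U> assume U: "(\<forall>U\<in>\<U>. openin (weak_topology smul) U) \<and> K \<subseteq> \<Union>\<U>"
  then have "\<And>U. U \<in> \<U> \<Longrightarrow> open U" using openin_weak_imp_open by blast
  from compactE[OF assms conjunct2[OF U] this]
  show "\<exists>\<F>. finite \<F> \<and> \<F> \<subseteq> \<U> \<and> K \<subseteq> \<Union>\<F>" by metis
qed simp

text \<open>A point outside \<open>C\<close> has positive distance \<open>d\<close> from it, and
  separation with gap \<open>d\<close> puts the point into a weakly open half-space that misses
  \<open>C\<close>.\<close>

lemma closedin_weak_of_convex:
  assumes "convex C" "closed C"
  shows "closedin (weak_topology smul) C"
proof (cases "C = {}")
  case False
  have "\<exists>T. openin (weak_topology smul) T \<and> z \<in> T \<and> T \<subseteq> - C" if "z \<in> - C" for z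
  proof -
    define d where "d = infdist z C"
    have d: "d > 0" unfolding d_def using assms False that
      by (metis ComplD in_closed_iff_infdist_zero infdist_nonneg less_le)
    have "d \<le> norm (z - c)" if "c \<in> C" for c
      unfolding d_def using infdist_le[OF that, of z] by (simp add: dist_norm)
    then obtain g :: "'a \<Rightarrow>\<^sub>L real" where g: "\<And>c. c \<in> C \<Longrightarrow> blinfun_apply g c + d \<le> blinfun_apply g z"
      using Hahn_Banach_separation[OF assms(1) False] by metis
    obtain f where f: "f \<in> dual smul" "\<And>y. re (f y) = blinfun_apply g y" using ex_dual_re by blast
    have "open {u :: 'k. re u > blinfun_apply g z - d}"
      by (intro open_Collect_less continuous_intros)
    from openin_weak_vimage[OF f(1) this] show ?thesis
      using d g f(2) by (force intro!: exI[of _ "f -` {u. re u > blinfun_apply g z - d}"])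
  qed
  then have "openin (weak_topology smul) (- C)" by (subst openin_subopen) blast
  then show ?thesis by (simp add: closedin_def Compl_eq_Diff_UNIV)
qed simp

text \<open>Convexity makes \<open>K\<close> weakly closed, so \<open>K\<close> contains the weak
  closure of the image, which is then a closed subset of a weakly compact set.\<close>

lemma weakly_compact_map_if_compact:
  assumes "\<Psi> ` cball 0 1 \<subseteq> K" "compact K" "convex K"
  shows "weakly_compact_map smul \<Psi>"
  unfolding weakly_compact_map_def
proof (rule closed_compactin[OF compactin_weak_of_compact[OF assms(2)]])
  show "weak_topology smul closure_of \<Psi> ` cball 0 1 \<subseteq> K"
    using assms by (intro closure_of_minimal closedin_weak_of_convex compact_imp_closed)
qed simp

text \<open>The weak closures of the tails have the finite intersection property. The point common
  to all of them is described by closed conditions on one functional at a time, the form in which it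
  is applied.\<close>

lemma compactin_weak_cluster:
  fixes z :: "nat \<Rightarrow> 'a"
  assumes K: "compactin (weak_topology smul) K" and z: "range z \<subseteq> K"
  obtains w where "w \<in> K"
    "\<And>f U N. f \<in> dual smul \<Longrightarrow> closed U \<Longrightarrow> (\<And>n. n \<ge> N \<Longrightarrow> f (z n) \<in> U) \<Longrightarrow> f w \<in> U"
proof -
  define \<U> where "\<U> = range (\<lambda>N. weak_topology smul closure_of (z ` {N..}))"
  have sub: "z ` {N..} \<subseteq> weak_topology smul closure_of (z ` {N..})" for N
    by (rule closure_of_subset) simp
  have "K \<inter> \<Inter>\<U> \<noteq> {}"
  proof (rule compactin_fip[THEN iffD1, OF K, THEN conjunct2, rule_format])
    show "(\<forall>C\<in>\<U>. closedin (weak_topology smul) C) \<and> (\<forall>\<F>. finite \<F> \<and> \<F> \<subseteq> \<U> \<longrightarrow> K \<inter> \<Inter>\<F> \<noteq> {})"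
    proof (intro conjI allI impI)
      show "\<forall>C\<in>\<U>. closedin (weak_topology smul) C" by (auto simp: \<U>_def)
      fix \<F> assume "finite \<F> \<and> \<F> \<subseteq> \<U>"
      then obtain I where I: "finite I" "\<F> = (\<lambda>N. weak_topology smul closure_of (z ` {N..})) ` I"
        unfolding \<U>_def by (metis finite_subset_image)
      have m: "N \<le> Max I" if "N \<in> I" for N using I(1) that by simp
      have "z (Max I) \<in> weak_topology smul closure_of (z ` {N..})" if "N \<in> I" for N
        using m[OF that] sub[of N] by (meson atLeast_iff image_eqI subsetD)
      then have "z (Max I) \<in> \<Inter>\<F>" unfolding I(2) by blast
      then show "K \<inter> \<Inter>\<F> \<noteq> {}" using z by blast
    qed
  qed
  then obtain w where w: "w \<in> K" "\<And>N. w \<in> weak_topology smul closure_of (z ` {N..})"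
    by (auto simp: \<U>_def)
  show thesis
  proof (rule that[OF w(1)])
    fix f U N assume f: "f \<in> dual smul" "closed U" and U: "\<And>n. n \<ge> N \<Longrightarrow> f (z n) \<in> U"
    have "weak_topology smul closure_of (z ` {N..}) \<subseteq> f -` U"
      using closedin_weak_vimage[OF f] U by (intro closure_of_minimal) auto
    then show "f w \<in> U" using w by blast
  qed
qed

text \<open>Closing up under unimodular scalars makes the supremum of the real part of a functional
  equal to the supremum of its modulus over \<open>K\<close>.\<close>

definition circled :: "'a set \<Rightarrow> 'a set" where
  "circled K = {smul \<omega> w | \<omega> w. norm \<omega> = 1 \<and> w \<in> K}"

text \<open>Write the sequence as scalars times points of \<open>K\<close>. A subsequence of the
  scalars converges, and its limit times a weak cluster point of the corresponding points of
  \<open>K\<close> is the required point.\<close>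

lemma circled_cluster:
  fixes z :: "nat \<Rightarrow> 'a"
  assumes K: "compactin (weak_topology smul) K" and M: "\<And>w. w \<in> K \<Longrightarrow> norm w \<le> M"
    and z: "range z \<subseteq> circled K"
  shows "\<exists>w\<in>circled K. \<forall>g :: 'a \<Rightarrow>\<^sub>L real. \<forall>N c.
    (\<forall>n\<ge>N. blinfun_apply g (z n) \<le> c) \<longrightarrow> blinfun_apply g w \<le> c"
proof -
  have "z n \<in> circled K" for n using z by blast
  then have "\<forall>n. \<exists>\<omega> k. z n = smul \<omega> k \<and> norm \<omega> = 1 \<and> k \<in> K"
    unfolding circled_def by blast
  then obtain \<omega> k where wk: "\<And>n. z n = smul (\<omega> n) (k n)" "\<And>n. norm (\<omega> n) = 1" "\<And>n. k n \<in> K" by metis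
  have "seq_compact (cball (0::'k) 1)"
    using compact_cball_real_or_complex compact_eq_seq_compact_metric by blast
  then obtain \<omega>0 \<sigma> where \<sigma>: "strict_mono \<sigma>" "(\<omega> \<circ> \<sigma>) \<longlonglongrightarrow> \<omega>0"
    using wk(2) unfolding seq_compact_def by (metis dist_0_norm mem_cball order_refl)
  have "(\<lambda>n. norm ((\<omega> \<circ> \<sigma>) n)) \<longlonglongrightarrow> norm \<omega>0" using \<sigma>(2) by (rule tendsto_norm)
  then have norm1: "norm \<omega>0 = 1" by (simp add: comp_def wk(2) LIMSEQ_const_iff)
  obtain w where w: "w \<in> K" "\<And>f U N. f \<in> dual smul \<Longrightarrow> closed U \<Longrightarrow> (\<And>n. n \<ge> N \<Longrightarrow> f (k (\<sigma> n)) \<in> U) \<Longrightarrow> f w \<in> U"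
    using compactin_weak_cluster[OF K, of "k \<circ> \<sigma>"] wk(3) by (metis comp_apply image_subsetI)
  show ?thesis
  proof (intro bexI[of _ "smul \<omega>0 w"] allI impI)
    show "smul \<omega>0 w \<in> circled K" using norm1 w by (auto simp: circled_def)
    fix g :: "'a \<Rightarrow>\<^sub>L real" and N c assume le: "\<forall>n\<ge>N. blinfun_apply g (z n) \<le> c"
    obtain f where f: "f \<in> dual smul" "\<And>y. re (f y) = blinfun_apply g y" using ex_dual_re by blast
    show "blinfun_apply g (smul \<omega>0 w) \<le> c"
    proof (rule field_le_epsilon)
      fix e :: real assume e: "e > 0"
      have "(\<lambda>n. norm (\<omega>0 - (\<omega> \<circ> \<sigma>) n) * (norm g * M)) \<longlonglongrightarrow> norm (\<omega>0 - \<omega>0) * (norm g * M)"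
        by (intro tendsto_intros \<sigma>)
      then have "\<forall>\<^sub>F n in sequentially. norm (\<omega>0 - (\<omega> \<circ> \<sigma>) n) * (norm g * M) < e"
        using e by (intro order_tendstoD(2)) auto
      then obtain N' where N': "\<And>n. n \<ge> N' \<Longrightarrow> norm (\<omega>0 - \<omega> (\<sigma> n)) * (norm g * M) < e"
        by (auto simp: eventually_sequentially)
      have fm: "re (u * f y) = blinfun_apply g (smul u y)" for u y
        using f by (auto simp: dual_def simp flip: f(2))
      \<comment> \<open>With the scalar frozen at its limit \<open>\<omega>0\<close>, the bound
        becomes a closed condition on the single functional \<open>f\<close>. The slack
        \<open>e\<close> pays for replacing \<open>\<omega> (\<sigma> n)\<close> by
        \<open>\<omega>0\<close>, uniformly because \<open>K\<close> is bounded by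
        \<open>M\<close>.\<close>
      have "f w \<in> {u. re (\<omega>0 * u) \<le> c + e}"
      proof (rule w(2)[OF f(1)])
        show "closed {u. re (\<omega>0 * u) \<le> c + e}" by (intro closed_Collect_le continuous_intros)
        fix n assume n: "n \<ge> max N N'"
        have "blinfun_apply g (smul (\<omega>0 - \<omega> (\<sigma> n)) (k (\<sigma> n))) \<le> norm g * (norm (\<omega>0 - \<omega> (\<sigma> n)) * M)"
          using M wk(3) by (intro blinfun_apply_le order_refl) (simp add: norm_scale mult_left_mono)
        also have "\<dots> < e" using N'[of n] n by (simp add: ac_simps)
        finally have "blinfun_apply g (smul \<omega>0 (k (\<sigma> n))) \<le> blinfun_apply g (z (\<sigma> n)) + e"
          by (simp add: wk scale_left_diff_distrib blinfun.diff_right)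
        moreover have "\<sigma> n \<ge> N" using n seq_suble[OF \<sigma>(1), of n] by simp
        ultimately have "blinfun_apply g (smul \<omega>0 (k (\<sigma> n))) \<le> c + e" using le by fastforce
        then show "f (k (\<sigma> n)) \<in> {u. re (\<omega>0 * u) \<le> c + e}" by (simp add: fm)
      qed
      then show "blinfun_apply g (smul \<omega>0 w) \<le> c + e" by (simp add: fm)
    qed
  qed
qed

end

subsection \<open>The Daugavet equation\<close>

lemma linf_ball_bdd_above:
  assumes "f \<in> linf_ball"
  shows "bdd_above ((\<lambda>x. norm (f x)) ` cball 0 1)"
  using assms unfolding linf_ball_def bounded_iff bdd_above_def by auto

lemma norm_le_sup_norm: "f \<in> linf_ball \<Longrightarrow> x \<in> cball 0 1 \<Longrightarrow> norm (f x) \<le> sup_norm f"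
  unfolding sup_norm_def by (rule cSUP_upper[OF _ linf_ball_bdd_above])

lemma sup_norm_le:
  fixes f :: "'x::real_normed_vector \<Rightarrow> 'y::real_normed_vector"
  shows "(\<And>x. x \<in> cball 0 1 \<Longrightarrow> norm (f x) \<le> c) \<Longrightarrow> sup_norm f \<le> c"
  unfolding sup_norm_def by (rule cSUP_least) auto

lemma sup_norm_nonneg: "f \<in> linf_ball \<Longrightarrow> 0 \<le> sup_norm f"
  using norm_le_sup_norm[of f 0] by (auto intro: order_trans[OF norm_ge_zero])

lemma ex_norm_gt_sup_norm:
  fixes f :: "'x::real_normed_vector \<Rightarrow> 'y::real_normed_vector"
  assumes "c < sup_norm f"
  obtains x where "x \<in> cball 0 1" "c < norm (f x)"
  using sup_norm_le[of f c] assms by (meson not_le)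

lemma linf_ball_add:
  fixes f g :: "'x::real_normed_vector \<Rightarrow> 'y::real_normed_vector"
  assumes "f \<in> linf_ball" "g \<in> linf_ball"
  shows "f + g \<in> linf_ball"
proof -
  have "norm ((f + g) x) \<le> sup_norm f + sup_norm g" if "x \<in> cball 0 1" for x
    using norm_le_sup_norm[OF assms(1) that] norm_le_sup_norm[OF assms(2) that]
      norm_triangle_ineq[of "f x" "g x"] by simp
  then have "bounded ((f + g) ` cball 0 1)" unfolding bounded_iff by blast
  then show ?thesis using assms by (auto simp: linf_ball_def)
qed

lemma sup_norm_add_le:
  assumes "f \<in> linf_ball" "g \<in> linf_ball"
  shows "sup_norm (f + g) \<le> sup_norm f + sup_norm g"
proof (rule sup_norm_le)
  fix x :: 'a assume "x \<in> cball 0 1"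
  then show "norm ((f + g) x) \<le> sup_norm f + sup_norm g"
    using norm_le_sup_norm[OF assms(1)] norm_le_sup_norm[OF assms(2)]
    by (simp add: norm_triangle_mono)
qed

lemma sup_norm_scale_fun:
  fixes f :: "'x::real_normed_vector \<Rightarrow> 'k::real_or_complex"
  assumes f: "f \<in> linf_ball"
  shows "sup_norm (scale_fun c f) = norm c * sup_norm f"
proof (cases "c = 0")
  case True
  then show ?thesis by (simp add: sup_norm_def scale_fun_def)
next
  case False
  show ?thesis
  proof (rule antisym)
    show "sup_norm (scale_fun c f) \<le> norm c * sup_norm f"
      by (rule sup_norm_le) (auto simp: scale_fun_def norm_mult intro!: mult_left_mono norm_le_sup_norm[OF f])
    have sc: "scale_fun c f \<in> linf_ball"
      using subspace_linf_ball f by (rule scale_fun.subspace_scale)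
    have "sup_norm f \<le> sup_norm (scale_fun c f) / norm c"
    proof (rule sup_norm_le)
      fix x :: 'x assume "x \<in> cball 0 1"
      from norm_le_sup_norm[OF sc this] show "norm (f x) \<le> sup_norm (scale_fun c f) / norm c"
        using False by (simp add: scale_fun_def norm_mult field_simps)
    qed
    then show "norm c * sup_norm f \<le> sup_norm (scale_fun c f)" using False by (simp add: field_simps)
  qed
qed

text \<open>Near-additivity of the norm at \<open>a + y\<close> passes to all
  \<open>a + m *\<^sub>R y\<close> by the triangle inequality: for \<open>m \<ge> 1\<close> subtract
  \<open>m - 1\<close> copies of \<open>a\<close> from \<open>m\<close> copies of
  \<open>a + y\<close>, otherwise subtract \<open>1 - m\<close> copies of \<open>y\<close> from
  \<open>a + y\<close>.\<close>

lemma norm_add_scaleR_ge: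
  fixes a y :: "'a::real_normed_vector"
  assumes a: "norm a \<le> 1" and y: "norm y = 1" and ay: "2 - \<eta> \<le> norm (a + y)"
    and "\<eta> \<ge> 0" "m \<ge> 0"
  shows "1 + m - \<eta> * (1 + m) \<le> norm (a + m *\<^sub>R y)"
proof (cases "m \<ge> 1")
  case True
  have "m * norm (a + y) = norm ((a + m *\<^sub>R y) + (m - 1) *\<^sub>R a)"
    using True norm_scaleR[of m "a + y"] by (simp add: algebra_simps)
  also have "\<dots> \<le> norm (a + m *\<^sub>R y) + (m - 1) * norm a"
    using True norm_triangle_ineq[of "a + m *\<^sub>R y" "(m - 1) *\<^sub>R a"] by simp
  finally have "m * norm (a + y) \<le> norm (a + m *\<^sub>R y) + (m - 1) * norm a" .
  moreover have "m * (2 - \<eta>) \<le> m * norm (a + y)" using ay True by (intro mult_left_mono) auto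
  moreover have "(m - 1) * norm a \<le> (m - 1) * 1" using a True by (intro mult_left_mono) auto
  ultimately show ?thesis using assms by (simp add: algebra_simps)
next
  case False
  have "norm (a + y) = norm ((a + m *\<^sub>R y) + (1 - m) *\<^sub>R y)" by (simp add: algebra_simps)
  also have "\<dots> \<le> norm (a + m *\<^sub>R y) + (1 - m)"
    using False y norm_triangle_ineq[of "a + m *\<^sub>R y" "(1 - m) *\<^sub>R y"] by simp
  finally have "norm (a + y) \<le> norm (a + m *\<^sub>R y) + (1 - m)" .
  moreover have "0 \<le> \<eta> * m" using assms by simp
  ultimately show ?thesis using ay by (simp add: algebra_simps)
qed

context banach_space_over
begin

section \<open>Rank-one maps and the three implications\<close>

lemma norm_tensor: "norm (tensor smul x' y x) = norm (x' x) * norm y"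
  by (simp add: tensor_def norm_scale)

lemma tensor_in_linf_ball:
  assumes "x' \<in> linf_ball"
  shows "tensor smul x' y \<in> linf_ball"
proof -
  have "norm (tensor smul x' y x) \<le> sup_norm x' * norm y" if "x \<in> cball 0 1" for x
    using norm_le_sup_norm[OF assms that] by (simp add: norm_tensor mult_right_mono)
  then have "bounded (tensor smul x' y ` cball 0 1)" unfolding bounded_iff by blast
  then show ?thesis using assms by (auto simp: linf_ball_def tensor_def)
qed

text \<open>The image lies in the multiples of \<open>y\<close> by scalars of modulus at most
  \<open>sup_norm x'\<close>, a compact convex set.\<close>

lemma weakly_compact_tensor:
  assumes "x' \<in> linf_ball"
  shows "weakly_compact_map smul (tensor smul x' y)"
proof (rule weakly_compact_map_if_compact)
  let ?K = "(\<lambda>c. smul c y) ` cball 0 (sup_norm x')"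
  show "tensor smul x' y ` cball 0 1 \<subseteq> ?K"
    using norm_le_sup_norm[OF assms] by (force simp: tensor_def)
  show "compact ?K"
    by (intro compact_continuous_image linear_continuous_on bounded_linear_smul_left compact_cball_real_or_complex)
  show "convex ?K"
    by (intro convex_linear_image bounded_linear.linear[OF bounded_linear_smul_left] convex_cball)
qed

lemma dual_comp_tensor:
  assumes "f \<in> dual smul"
  shows "f \<circ> tensor smul x' y = scale_fun (f y) x'"
  using assms by (auto simp: dual_def tensor_def scale_fun_def)

text \<open>At a point where the norm of the sum is almost attained, the scalar \<open>x' x\<close>
  has modulus almost 1. A rotation \<open>\<omega>\<close> makes it real and positive, and replacing
  it by 1 costs at most \<open>\<epsilon> / 2\<close>.\<close>

lemma ex_point_of_tensor_norm:
  assumes x': "x' \<in> linf_ball" "sup_norm x' = 1" and y: "norm y = 1"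
    and \<Phi>: "\<Phi> \<in> linf_ball" "sup_norm \<Phi> = 1"
    and norm2: "sup_norm (\<Phi> + tensor smul x' y) = sup_norm \<Phi> + sup_norm (tensor smul x' y)"
    and e: "\<epsilon> > 0"
  shows "\<exists>\<omega>\<in>sphere 0 1. \<exists>x\<in>cball 0 1.
    re (\<omega> * x' x) \<ge> 1 - \<epsilon> \<and> norm (smul \<omega> (\<Phi> x) + y) \<ge> 2 - \<epsilon>"
proof -
  have "sup_norm (tensor smul x' y) = 1"
    using x'(2) y unfolding sup_norm_def by (simp add: norm_tensor)
  then have "2 - \<epsilon> / 2 < sup_norm (\<Phi> + tensor smul x' y)" using norm2 \<Phi> e by simp
  from ex_norm_gt_sup_norm[OF this]
  obtain x where x: "x \<in> cball 0 1" "2 - \<epsilon> / 2 < norm (\<Phi> x + smul (x' x) y)"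
    by (auto simp: tensor_def)
  have "norm (\<Phi> x) \<le> 1" "norm (x' x) \<le> 1" using norm_le_sup_norm[OF _ x(1)] \<Phi> x' by fastforce+
  moreover have "norm (\<Phi> x + smul (x' x) y) \<le> norm (\<Phi> x) + norm (x' x)"
    using norm_triangle_ineq[of "\<Phi> x" "smul (x' x) y"] y by (simp add: norm_scale)
  ultimately have x'x: "1 - \<epsilon> / 2 < norm (x' x)" using x by linarith
  obtain \<omega> where \<omega>: "norm \<omega> = 1" "\<omega> * x' x = of_real (norm (x' x))" using ex_unimodular by blast
  have "norm (\<Phi> x + smul (x' x) y) = norm (smul \<omega> (\<Phi> x + smul (x' x) y))" by (simp add: norm_scale \<omega>)
  also have "smul \<omega> (\<Phi> x + smul (x' x) y) = (smul \<omega> (\<Phi> x) + y) - (1 - norm (x' x)) *\<^sub>R y"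
    by (simp add: scale_right_distrib \<omega> scale_of_real algebra_simps)
  also have "norm \<dots> \<le> norm (smul \<omega> (\<Phi> x) + y) + (1 - norm (x' x))"
    using norm_triangle_ineq4[of "smul \<omega> (\<Phi> x) + y" "(1 - norm (x' x)) *\<^sub>R y"] y \<open>norm (x' x) \<le> 1\<close> by simp
  finally have "2 - \<epsilon> \<le> norm (smul \<omega> (\<Phi> x) + y)" using x x'x by linarith
  moreover have "1 - \<epsilon> \<le> re (\<omega> * x' x)" using \<omega> x'x e by simp
  ultimately show ?thesis using \<omega> x by (intro bexI[of _ \<omega>] bexI[of _ x]) auto
qed

text \<open>Rotations turn the modulus into a real part, which gives one inequality. For the other,
  a bound on the modulus of \<open>f\<close> is a weakly closed condition, so it extends from the
  image to its weak closure.\<close>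

lemma sup_norm_dual_comp:
  fixes \<Psi> :: "'x::real_normed_vector \<Rightarrow> 'a"
  assumes \<Psi>: "\<Psi> \<in> linf_ball" and f: "f \<in> dual smul" "\<And>y. re (f y) = blinfun_apply g y"
    and f\<Psi>: "f \<circ> \<Psi> \<in> linf_ball"
    and M: "\<And>w. w \<in> W \<Longrightarrow> norm w \<le> M" "M > 0"
    and W: "W = circled (weak_topology smul closure_of (\<Psi> ` cball 0 1))"
  shows "sup_norm (f \<circ> \<Psi>) = support_fun W g"
proof (rule antisym)
  have sub: "\<Psi> ` cball 0 1 \<subseteq> weak_topology smul closure_of (\<Psi> ` cball 0 1)"
    by (rule closure_of_subset) simp
  have inW: "smul \<omega> (\<Psi> x) \<in> W" if "norm \<omega> = 1" "x \<in> cball 0 1" for \<omega> x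
    unfolding W circled_def using that sub by blast
  then have ne: "W \<noteq> {}" using norm_one by (metis centre_in_cball empty_iff zero_le_one)
  show "sup_norm (f \<circ> \<Psi>) \<le> support_fun W g"
  proof (rule sup_norm_le)
    fix x :: 'x assume x: "x \<in> cball 0 1"
    obtain \<omega> where \<omega>: "norm \<omega> = 1" "\<omega> * f (\<Psi> x) = of_real (norm (f (\<Psi> x)))" using ex_unimodular by blast
    have "f (smul \<omega> (\<Psi> x)) = of_real (norm (f (\<Psi> x)))" using f(1) \<omega>(2) by (simp add: dual_def)
    then have "norm (f (\<Psi> x)) = blinfun_apply g (smul \<omega> (\<Psi> x))" using f(2) re_of_real by metis
    also have "\<dots> \<le> support_fun W g" using le_support_fun[OF ne M] inW[OF \<omega>(1) x] by blast
    finally show "norm ((f \<circ> \<Psi>) x) \<le> support_fun W g" by simp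
  qed
  show "support_fun W g \<le> sup_norm (f \<circ> \<Psi>)"
  proof (rule support_fun_le[OF ne M])
    have "weak_topology smul closure_of (\<Psi> ` cball 0 1) \<subseteq> f -` cball 0 (sup_norm (f \<circ> \<Psi>))"
      using norm_le_sup_norm[OF f\<Psi>]
      by (intro closure_of_minimal closedin_weak_vimage f closed_cball) auto
    moreover fix w assume "w \<in> W"
    then obtain \<omega> k where k: "w = smul \<omega> k" "norm \<omega> = 1" "k \<in> weak_topology smul closure_of (\<Psi> ` cball 0 1)"
      unfolding W circled_def by blast
    ultimately have "norm (f k) \<le> sup_norm (f \<circ> \<Psi>)" by (simp add: subset_iff)
    moreover have "blinfun_apply g w = re (\<omega> * f k)" using f k by (simp add: dual_def flip: f(2))
    moreover have "re (\<omega> * f k) \<le> norm (f k)" using re_le_norm[of "\<omega> * f k"] k by (simp add: norm_mult)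
    ultimately show "blinfun_apply g w \<le> sup_norm (f \<circ> \<Psi>)" by simp
  qed
qed

text \<open>A functional near one that almost norms \<open>\<Psi>\<close> has a small slice. The
  point condition, applied to its normalised composite with \<open>\<Psi>\<close> and to the
  direction of a point \<open>y0\<close> of the slice, yields a rotated value of
  \<open>\<Psi>\<close> in the same slice.\<close>

lemma sup_norm_add_weakly_compact:
  fixes \<Phi> \<Psi> :: "'c::real_normed_vector \<Rightarrow> 'a"
  assumes Z: "Z \<subseteq> linf_ball" "scale_fun.subspace Z"
    and \<Phi>: "\<Phi> \<in> linf_ball" "sup_norm \<Phi> = 1"
    and point: "\<And>x' y \<epsilon>. x' \<in> Z \<Longrightarrow> sup_norm x' = 1 \<Longrightarrow> norm y = 1 \<Longrightarrow> \<epsilon> > 0 \<Longrightarrow>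
      \<exists>\<omega>\<in>sphere 0 1. \<exists>x\<in>cball 0 1. re (\<omega> * x' x) \<ge> 1 - \<epsilon> \<and> norm (smul \<omega> (\<Phi> x) + y) \<ge> 2 - \<epsilon>"
    and \<Psi>: "\<Psi> \<in> linf_ball" "weakly_compact_map smul \<Psi>" "\<And>f. f \<in> dual smul \<Longrightarrow> f \<circ> \<Psi> \<in> Z"
  shows "sup_norm (\<Phi> + \<Psi>) = sup_norm \<Phi> + sup_norm \<Psi>"
proof (rule antisym[OF sup_norm_add_le[OF \<Phi>(1) \<Psi>(1)]])
  define M where "M = sup_norm \<Psi>"
  show "sup_norm \<Phi> + sup_norm \<Psi> \<le> sup_norm (\<Phi> + \<Psi>)"
  proof (cases "M = 0")
    case True
    then have "\<Psi> x = 0" for x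
      using norm_le_sup_norm[OF \<Psi>(1), of x] \<Psi>(1) by (cases "x \<in> cball 0 1") (auto simp: M_def linf_ball_def)
    then have "\<Phi> + \<Psi> = \<Phi>" by auto
    then show ?thesis using True by (simp add: M_def)
  next
    case False
    then have M: "M > 0" using sup_norm_nonneg[OF \<Psi>(1)] by (simp add: M_def)
    define K where "K = weak_topology smul closure_of (\<Psi> ` cball 0 1)"
    define W where "W = circled K"
    have K: "compactin (weak_topology smul) K" using \<Psi>(2) by (simp add: K_def weakly_compact_map_def)
    have "K \<subseteq> cball 0 M" unfolding K_def
      using norm_le_sup_norm[OF \<Psi>(1)] by (intro closure_of_minimal closedin_weak_of_convex) (auto simp: M_def)
    then have KM: "norm w \<le> M" if "w \<in> K" for w using that by auto
    then have WM: "norm w \<le> M" if "w \<in> W" for w using that by (auto simp: W_def circled_def norm_scale)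
    have sub: "\<Psi> ` cball 0 1 \<subseteq> K" unfolding K_def by (rule closure_of_subset) simp
    have inW: "smul \<omega> (\<Psi> x) \<in> W" if "norm \<omega> = 1" "x \<in> cball 0 1" for \<omega> x
      unfolding W_def circled_def using that sub by blast
    have inW1: "\<Psi> x \<in> W" if "x \<in> cball 0 1" for x using inW[of 1 x] that by simp
    have W_ne: "W \<noteq> {}" using inW1[of 0] by auto
    note small_slice = ex_small_slice[OF W_ne WM M circled_cluster[OF K KM, folded W_def]]
    show ?thesis
    proof (rule field_le_epsilon)
      fix e :: real assume e: "e > 0"
      \<comment> \<open>The losses below are \<open>4 * \<eta>\<close> in \<open>m\<close>, at most
        \<open>\<eta> * (1 + M)\<close> from the point condition, and \<open>2 * \<eta>\<close> from
        the slice, in total \<open>\<eta> * (7 + M)\<close>. The bound \<open>M / 8\<close> keeps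
        \<open>s\<close> and \<open>m\<close> positive.\<close>
      define \<eta> where "\<eta> = min (e / (7 + M)) (M / 8)"
      have \<eta>: "\<eta> > 0" "\<eta> \<le> M / 8" using e M by (simp_all add: \<eta>_def del: le_divide_eq_numeral1)
      have "\<eta> \<le> e / (7 + M)" by (simp add: \<eta>_def)
      then have \<eta>e: "\<eta> * (7 + M) \<le> e" using M by (simp add: field_simps)
      obtain x0 where x0: "x0 \<in> cball 0 1" "M - \<eta> < norm (\<Psi> x0)"
        using ex_norm_gt_sup_norm[of "M - \<eta>" \<Psi>] \<eta> by (auto simp: M_def)
      obtain g0 :: "'a \<Rightarrow>\<^sub>L real" where g0: "norm g0 \<le> 1" "blinfun_apply g0 (\<Psi> x0) = norm (\<Psi> x0)"
        using ex_norming_functional by blast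
      \<comment> \<open>A perturbation of \<open>g0\<close> by less than this radius changes its
        values on \<open>W\<close> by at most \<open>\<eta>\<close>.\<close>
      have r: "\<eta> / M > 0" using \<eta> M by simp
      obtain g \<delta>0 c where g: "dist g0 g < \<eta> / M" and "\<delta>0 > 0"
        and slice0: "\<And>w. w \<in> W \<Longrightarrow> support_fun W g - \<delta>0 < blinfun_apply g w \<Longrightarrow> norm (w - c) \<le> \<eta>"
        by (rule small_slice[where ?g0.0 = g0, OF _ _ _ \<eta>(1) r]) blast+
      \<comment> \<open>A thinner slice is still small, and \<open>\<delta> \<le> \<eta>\<close>
        also forces its points to have norm at least \<open>M - 4 * \<eta>\<close>.\<close>
      define \<delta> where "\<delta> = min \<delta>0 \<eta>"
      have \<delta>: "\<delta> > 0" "\<delta> \<le> \<eta>" using \<open>\<delta>0 > 0\<close> \<eta> by (auto simp: \<delta>_def)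
      have slice: "norm (w - c) \<le> \<eta>" if "w \<in> W" "support_fun W g - \<delta> < blinfun_apply g w" for w
        using slice0 that by (simp add: \<delta>_def)
      have gM: "dist g0 g * M \<le> \<eta>" using g M by (simp add: field_simps)
      define s where "s = support_fun W g"
      have "blinfun_apply g (\<Psi> x0) \<le> s" unfolding s_def by (rule le_support_fun[OF W_ne WM M inW1[OF x0(1)]])
      then have s_ge: "M - 2 * \<eta> \<le> s"
        using blinfun_apply_le_add_dist[OF WM[OF inW1[OF x0(1)]], of g0 g] g0 x0 gM by simp
      then have s: "s > 0" using \<eta> M by linarith
      obtain y0 where y0: "y0 \<in> W" "s - \<delta> < blinfun_apply g y0"
        using ex_gt_support_fun[OF W_ne WM M \<delta>(1), of g] by (auto simp: s_def)
      define m where "m = norm y0"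
      have "blinfun_apply g0 y0 \<le> 1 * m" by (rule blinfun_apply_le[OF g0(1)]) (simp add: m_def)
      then have m_ge: "M - 4 * \<eta> \<le> m"
        using blinfun_apply_le_add_dist[OF WM[OF y0(1)], of g g0] y0(2) s_ge \<delta>(2) gM by (simp add: dist_commute)
      then have m: "m > 0" using \<eta> M by linarith
      have mM: "m \<le> M" using WM[OF y0(1)] by (simp add: m_def)
      define y where "y = (1 / m) *\<^sub>R y0"
      have y: "norm y = 1" "m *\<^sub>R y = y0" using m by (auto simp: y_def m_def)
      obtain f where f: "f \<in> dual smul" "\<And>y. re (f y) = blinfun_apply g y" using ex_dual_re by blast
      have f\<Psi>: "f \<circ> \<Psi> \<in> Z" using \<Psi>(3) f(1) by blast
      have sup_f: "sup_norm (f \<circ> \<Psi>) = s" unfolding s_def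
        using sup_norm_dual_comp[OF \<Psi>(1) f _ WM M] f\<Psi> Z(1) by (auto simp: W_def K_def)
      define x' where "x' = scale_fun (of_real (1 / s)) (f \<circ> \<Psi>)"
      have x'Z: "x' \<in> Z" unfolding x'_def using Z(2) f\<Psi> by (rule scale_fun.subspace_scale)
      have "f \<circ> \<Psi> \<in> linf_ball" using f\<Psi> Z(1) by blast
      then have x'1: "sup_norm x' = 1"
        using s by (simp add: x'_def sup_norm_scale_fun sup_f norm_divide)
      \<comment> \<open>After rescaling by \<open>s\<close>, the second bound places the rotated
        value \<open>v\<close> in the slice of depth \<open>\<delta>\<close>.\<close>
      define \<epsilon> where "\<epsilon> = min \<eta> (\<delta> / (2 * s))"
      have \<epsilon>: "\<epsilon> > 0" "\<epsilon> \<le> \<eta>" using \<eta> \<delta> s by (auto simp: \<epsilon>_def)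
      have "\<epsilon> \<le> \<delta> / (2 * s)" by (simp add: \<epsilon>_def)
      then have \<epsilon>s: "s * \<epsilon> \<le> \<delta> / 2" using s by (simp add: field_simps)
      obtain \<omega> x where x: "norm \<omega> = 1" "x \<in> cball 0 1" "1 - \<epsilon> \<le> re (\<omega> * x' x)" "2 - \<epsilon> \<le> norm (smul \<omega> (\<Phi> x) + y)"
        using point[OF x'Z x'1 y(1) \<epsilon>(1)] by auto
      define v where "v = smul \<omega> (\<Psi> x)"
      have vW: "v \<in> W" unfolding v_def using inW x by blast
      have "re (\<omega> * x' x) = blinfun_apply g v / s"
      proof -
        have "\<omega> * x' x = f ((1 / s) *\<^sub>R v)"
          using f(1) unfolding x'_def v_def
          by (simp add: scale_fun_def dual_def ac_simps flip: scale_of_real)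
        then show ?thesis by (simp add: f(2) blinfun.scaleR_right)
      qed
      then have "s * (1 - \<epsilon>) \<le> blinfun_apply g v"
        using mult_left_mono[OF x(3), of s] s by simp
      then have "s - \<delta> < blinfun_apply g v" using \<epsilon>s \<delta>(1) by (simp add: algebra_simps)
      then have "norm (v - c) \<le> \<eta>" using slice vW by (simp add: s_def)
      moreover have "norm (y0 - c) \<le> \<eta>" using slice y0 by (simp add: s_def)
      ultimately have vy: "norm (y0 - v) \<le> 2 * \<eta>"
        using norm_triangle_ineq4[of "y0 - c" "v - c"] by simp
      have "norm (smul \<omega> (\<Phi> x)) \<le> 1" using norm_le_sup_norm[OF \<Phi>(1) x(2)] x(1) \<Phi>(2) by (simp add: norm_scale)
      then have "1 + m - \<eta> * (1 + m) \<le> norm (smul \<omega> (\<Phi> x) + y0)"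
        using norm_add_scaleR_ge[of "smul \<omega> (\<Phi> x)" y \<eta> m] y x(4) \<epsilon>(2) \<eta> m by simp
      also have "smul \<omega> (\<Phi> x) + y0 = smul \<omega> (\<Phi> x + \<Psi> x) + (y0 - v)"
        by (simp add: v_def scale_right_distrib)
      also have "norm \<dots> \<le> norm (smul \<omega> (\<Phi> x + \<Psi> x)) + 2 * \<eta>"
        using norm_triangle_ineq[of "smul \<omega> (\<Phi> x + \<Psi> x)" "y0 - v"] vy by simp
      also have "norm (smul \<omega> (\<Phi> x + \<Psi> x)) \<le> sup_norm (\<Phi> + \<Psi>)"
        using norm_le_sup_norm[OF linf_ball_add[OF \<Phi>(1) \<Psi>(1)] x(2)] x(1) by (simp add: norm_scale)
      finally have "1 + m - \<eta> * (1 + m) \<le> sup_norm (\<Phi> + \<Psi>) + 2 * \<eta>" by simp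
      moreover have "\<eta> * m \<le> \<eta> * M" using mM \<eta> by simp
      ultimately have "1 + M \<le> sup_norm (\<Phi> + \<Psi>) + \<eta> * (7 + M)" using m_ge by (simp add: algebra_simps)
      then show "sup_norm \<Phi> + sup_norm \<Psi> \<le> sup_norm (\<Phi> + \<Psi>) + e" using \<eta>e \<Phi>(2) by (simp add: M_def)
    qed
  qed
qed

end

theorem theorem3p15:
  fixes scaleX :: "'k::real_or_complex \<Rightarrow> 'a::banach \<Rightarrow> 'a"
    and scaleY :: "'k \<Rightarrow> 'b::banach \<Rightarrow> 'b"
    and Z :: "('a \<Rightarrow> 'k) set"
    and \<Phi> :: "'a \<Rightarrow> 'b"
  assumes "banach_space_over scaleX"
    and "banach_space_over scaleY"
    and "Z \<subseteq> linf_ball" and "scale_fun.subspace Z"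
    and "\<Phi> \<in> linf_ball" and "sup_norm \<Phi> = 1"
  shows
    "((\<forall>x'\<in>Z. \<forall>y.
         sup_norm (\<Phi> + tensor scaleY x' y) = sup_norm \<Phi> + sup_norm (tensor scaleY x' y))
      \<longleftrightarrow>
      (\<forall>x'\<in>Z. sup_norm x' = 1 \<longrightarrow> (\<forall>y\<in>sphere 0 1. \<forall>\<epsilon>>0.
         \<exists>\<omega>\<in>sphere 0 1. \<exists>x\<in>cball 0 1.
           re (\<omega> * x' x) \<ge> 1 - \<epsilon> \<and> norm (scaleY \<omega> (\<Phi> x) + y) \<ge> 2 - \<epsilon>)))
     \<and>
     ((\<forall>x'\<in>Z. sup_norm x' = 1 \<longrightarrow> (\<forall>y\<in>sphere 0 1. \<forall>\<epsilon>>0.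
         \<exists>\<omega>\<in>sphere 0 1. \<exists>x\<in>cball 0 1.
           re (\<omega> * x' x) \<ge> 1 - \<epsilon> \<and> norm (scaleY \<omega> (\<Phi> x) + y) \<ge> 2 - \<epsilon>))
      \<longleftrightarrow>
      (\<forall>\<Psi>\<in>linf_ball. weakly_compact_map scaleY \<Psi> \<longrightarrow> (\<forall>f\<in>dual scaleY. f \<circ> \<Psi> \<in> Z) \<longrightarrow>
         sup_norm (\<Phi> + \<Psi>) = sup_norm \<Phi> + sup_norm \<Psi>))"
    (is "(?A \<longleftrightarrow> ?B) \<and> (?B \<longleftrightarrow> ?C)")
proof -
  interpret Y: banach_space_over scaleY by fact
  note Z = assms(3,4) and \<Phi> = assms(5,6)
  have "?B" if A: ?A
  proof (intro ballI impI allI)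
    fix x' and y :: 'b and \<epsilon> :: real
    assume x': "x' \<in> Z" "sup_norm x' = 1" and y: "y \<in> sphere 0 1" and "\<epsilon> > 0"
    moreover have "sup_norm (\<Phi> + tensor scaleY x' y) = sup_norm \<Phi> + sup_norm (tensor scaleY x' y)"
      using A x' by blast
    ultimately show "\<exists>\<omega>\<in>sphere 0 1. \<exists>x\<in>cball 0 1.
        re (\<omega> * x' x) \<ge> 1 - \<epsilon> \<and> norm (scaleY \<omega> (\<Phi> x) + y) \<ge> 2 - \<epsilon>"
      using Z \<Phi> by (intro Y.ex_point_of_tensor_norm) auto
  qed
  moreover have "?C" if B: ?B
  proof (intro ballI impI)
    fix \<Psi> assume "\<Psi> \<in> linf_ball" "weakly_compact_map scaleY \<Psi>" "\<forall>f\<in>dual scaleY. f \<circ> \<Psi> \<in> Z"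
    then show "sup_norm (\<Phi> + \<Psi>) = sup_norm \<Phi> + sup_norm \<Psi>"
      using B by (intro Y.sup_norm_add_weakly_compact[OF Z \<Phi>]) auto
  qed
  moreover have "?A" if C: ?C
  proof (intro ballI allI)
    fix x' and y :: 'b assume x': "x' \<in> Z"
    \<comment> \<open>Composing with \<open>f\<close> gives the scalar multiple of \<open>x'\<close>
      by \<open>f y\<close>, which stays in the subspace \<open>Z\<close>.\<close>
    have "\<forall>f\<in>dual scaleY. f \<circ> tensor scaleY x' y \<in> Z"
      using scale_fun.subspace_scale[OF Z(2) x'] by (simp add: Y.dual_comp_tensor)
    moreover have "tensor scaleY x' y \<in> linf_ball" "weakly_compact_map scaleY (tensor scaleY x' y)"
      using Y.tensor_in_linf_ball Y.weakly_compact_tensor x' Z(1) by blast+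
    ultimately show "sup_norm (\<Phi> + tensor scaleY x' y) = sup_norm \<Phi> + sup_norm (tensor scaleY x' y)"
      using C by blast
  qed
  ultimately show ?thesis by argo
qed

end
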